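(* Let $\mathcal{G} = (V, \{C_1,\ldots,C_\tau\}, R)$ be a multi-layer graph on $n=|V|$ vertices whose robber layer $R$ is a tree. Then the problem Multi-layer cops and robber on input $(\mathcal{G},k)$ (deciding whether there is an allocation of $k$ cops to the cop layers with which the cop player has a winning strategy) can be solved in time $\mathcal{O}(f(k,\tau)\cdot \mathrm{poly}(n))$, where $k$ is the number of cops, $\tau$ is the number of cop layers of $\mathcal{G}$, $f$ is a computable function independent of $n$, and $\mathrm{poly}(n)$ is a fixed polynomial in $n$.
   Context: A multi-layer graph $\mathcal{G}=(V,\{C_1,\dots,C_\tau\},R)$ consists of a vertex set $V$, cop layers $C_1,\dots,C_\tau\subseteq\binom{V}{2}$ and a robber layer $R\subseteq\binom{V}{2}$ (each layer is an edge set on the common vertex set $V$). In multi-layer cops and robbers with an allocation $\mathbf{k}=(k_1,\dots,k_\tau)$, exactly $k_i$ cops are assigned to layer $C_i$ and the robber to $R$; each cop and the robber may only move along edges of their own layer and never change layer. The cop player first places all cops, then the robber is placed; then in alternating rounds (cops first) each cop may move along at most one edge of its layer (moving none, some or all cops), and then the robber may move along one edge of $R$ or stay. The cops win if at some point a cop occupies the robber's vertex; the robber wins by evading capture indefinitely. The problem Multi-layer cops and robber takes $(\mathcal{G},k)$ and asks whether some allocation $\mathbf{k}$ with $\sum_i k_i=k$ gives the cop player a winning strategy. *)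

theory Defs
  imports Main "HOL-Computational_Algebra.Polynomial"
begin

section \<open>Multi-layer graphs\<close>

text \<open>A layer is an edge set; the cop layers form a list, so the same edge set may occur as
  several layers.\<close>

record 'v mlgraph =
  verts :: "'v set"
  cop_layers :: "'v set set list"
  robber_layer :: "'v set set"

definition is_layer :: "'v set \<Rightarrow> 'v set set \<Rightarrow> bool" where
  "is_layer V E \<longleftrightarrow> (\<forall>e\<in>E. e \<subseteq> V \<and> card e = 2)"

definition multilayer_graph :: "'v mlgraph \<Rightarrow> bool" where
  "multilayer_graph G \<longleftrightarrow>
     finite (verts G) \<and> (\<forall>C\<in>set (cop_layers G). is_layer (verts G) C) \<and>
     is_layer (verts G) (robber_layer G)"

definition connected_graph :: "'v set \<Rightarrow> 'v set set \<Rightarrow> bool" where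
  "connected_graph V E \<longleftrightarrow> V \<noteq> {} \<and> (\<forall>u\<in>V. \<forall>v\<in>V. (u, v) \<in> {(x, y). {x, y} \<in> E}\<^sup>*)"

definition is_cycle :: "'v set set \<Rightarrow> 'v list \<Rightarrow> bool" where
  "is_cycle E xs \<longleftrightarrow>
     3 \<le> length xs \<and> distinct xs \<and>
     (\<forall>i. Suc i < length xs \<longrightarrow> {xs ! i, xs ! Suc i} \<in> E) \<and> {last xs, hd xs} \<in> E"

definition is_tree :: "'v set \<Rightarrow> 'v set set \<Rightarrow> bool" where
  "is_tree V E \<longleftrightarrow> connected_graph V E \<and> (\<nexists>xs. is_cycle E xs)"

section \<open>The game\<close>

definition step_along :: "'v set set \<Rightarrow> 'v \<Rightarrow> 'v \<Rightarrow> bool" where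
  "step_along E u v \<longleftrightarrow> u = v \<or> {u, v} \<in> E"

text \<open>For an allocation \<open>ks\<close>, the cop \<open>(i, j)\<close> is the \<open>j\<close>-th of the \<open>ks ! i\<close> cops on layer \<open>i\<close>
  (both counted from \<open>0\<close>).\<close>

definition cops :: "nat list \<Rightarrow> (nat \<times> nat) set" where
  "cops ks = {(i, j). i < length ks \<and> j < ks ! i}"

text \<open>A cop strategy maps the list of all robber positions so far to the positions of the cops:
  the empty list to their initial placement, and \<open>[r\<^sub>0, \<dots>, r\<^sub>t]\<close> to their positions after the cop
  move answering the robber being on \<open>r\<^sub>t\<close>.\<close>

type_synonym 'v cop_strategy = "'v list \<Rightarrow> nat \<times> nat \<Rightarrow> 'v"

definition legal_cop_strategy :: "'v mlgraph \<Rightarrow> nat list \<Rightarrow> 'v cop_strategy \<Rightarrow> bool" where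
  "legal_cop_strategy G ks \<sigma> \<longleftrightarrow>
     (\<forall>(i, j)\<in>cops ks. \<sigma> [] (i, j) \<in> verts G \<and>
        (\<forall>h v. step_along (cop_layers G ! i) (\<sigma> h (i, j)) (\<sigma> (h @ [v]) (i, j))))"

text \<open>\<open>r t\<close> is the position of the robber after its \<open>t\<close>-th move, \<open>r 0\<close> its initial placement.\<close>

definition robber_play :: "'v mlgraph \<Rightarrow> (nat \<Rightarrow> 'v) \<Rightarrow> bool" where
  "robber_play G r \<longleftrightarrow>
     r 0 \<in> verts G \<and> (\<forall>t. step_along (robber_layer G) (r t) (r (Suc t)))"

text \<open>Capture is possible both just after the robber has come to \<open>r t\<close> (the cops have seen
  \<open>r 0, \<dots>, r (t - 1)\<close>) and just after the following cop move (they have also seen \<open>r t\<close>).\<close>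

definition captures :: "nat list \<Rightarrow> 'v cop_strategy \<Rightarrow> (nat \<Rightarrow> 'v) \<Rightarrow> bool" where
  "captures ks \<sigma> r \<longleftrightarrow>
     (\<exists>t. \<exists>c\<in>cops ks. \<sigma> (map r [0..<t]) c = r t \<or> \<sigma> (map r [0..<Suc t]) c = r t)"

definition cops_win :: "'v mlgraph \<Rightarrow> nat list \<Rightarrow> bool" where
  "cops_win G ks \<longleftrightarrow>
     (\<exists>\<sigma>. legal_cop_strategy G ks \<sigma> \<and> (\<forall>r. robber_play G r \<longrightarrow> captures ks \<sigma> r))"

definition multilayer_cops_and_robber :: "'v mlgraph \<Rightarrow> nat \<Rightarrow> bool" where
  "multilayer_cops_and_robber G k \<longleftrightarrow>
     (\<exists>ks. length ks = length (cop_layers G) \<and> sum_list ks = k \<and> cops_win G ks)"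

section \<open>Model of computation\<close>

text \<open>A random access machine with structured control flow, whose memory is split into arrays
  (named by numbers) of natural numbers; a program mentions only finitely many arrays. Every
  elementary operation costs one time unit. The only arithmetic operations are addition and
  truncated subtraction: with unit-cost multiplication the machine would no longer be polynomially
  equivalent to Turing machines.\<close>

datatype expr =
    Const nat
  | Read nat expr
  | Add expr expr
  | Sub expr expr

datatype prog =
    Skip
  | Write nat expr expr
  | Seq prog prog
  | If expr prog prog
  | While expr prog

type_synonym state = "nat \<Rightarrow> nat \<Rightarrow> nat"

fun val :: "expr \<Rightarrow> state \<Rightarrow> nat" where
  "val (Const c) s = c"
| "val (Read a e) s = s a (val e s)"
| "val (Add e e') s = val e s + val e' s"
| "val (Sub e e') s = val e s - val e' s"

fun cost :: "expr \<Rightarrow> nat" where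
  "cost (Const c) = 1"
| "cost (Read a e) = cost e + 1"
| "cost (Add e e') = cost e + cost e' + 1"
| "cost (Sub e e') = cost e + cost e' + 1"

text \<open>\<open>exec P s t s'\<close>: started in \<open>s\<close>, program \<open>P\<close> halts in \<open>s'\<close> after exactly \<open>t\<close> time units.
  Conditions hold iff they are nonzero.\<close>

inductive exec :: "prog \<Rightarrow> state \<Rightarrow> nat \<Rightarrow> state \<Rightarrow> bool" where
  Skip: "exec Skip s 1 s"
| Write: "exec (Write a e e') s (cost e + cost e' + 1) (s(a := (s a)(val e s := val e' s)))"
| Seq: "exec P s t s' \<Longrightarrow> exec Q s' t' s'' \<Longrightarrow> exec (Seq P Q) s (t + t') s''"
| IfTrue: "val e s \<noteq> 0 \<Longrightarrow> exec P s t s' \<Longrightarrow> exec (If e P Q) s (cost e + 1 + t) s'"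
| IfFalse: "val e s = 0 \<Longrightarrow> exec Q s t s' \<Longrightarrow> exec (If e P Q) s (cost e + 1 + t) s'"
| WhileFalse: "val e s = 0 \<Longrightarrow> exec (While e P) s (cost e + 1) s"
| WhileTrue: "val e s \<noteq> 0 \<Longrightarrow> exec P s t s' \<Longrightarrow> exec (While e P) s' t' s'' \<Longrightarrow>
    exec (While e P) s (cost e + 1 + t + t') s''"

text \<open>The input is stored in array \<open>0\<close>, all other cells are \<open>0\<close>; the output is found in cell \<open>0\<close> of
  array \<open>0\<close>.\<close>

definition init_state :: "nat list \<Rightarrow> state" where
  "init_state xs = (\<lambda>a i. if a = 0 \<and> i < length xs then xs ! i else 0)"

definition computes_in_time :: "prog \<Rightarrow> nat list \<Rightarrow> nat \<Rightarrow> nat \<Rightarrow> bool" where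
  "computes_in_time P xs y t \<longleftrightarrow> (\<exists>s. exec P (init_state xs) t s \<and> s 0 0 = y)"

definition computable2 :: "(nat \<Rightarrow> nat \<Rightarrow> nat) \<Rightarrow> bool" where
  "computable2 f \<longleftrightarrow> (\<exists>P. \<forall>x y. \<exists>t. computes_in_time P [x, y] (f x y) t)"

section \<open>Encoding of instances\<close>

definition adj_matrix :: "nat \<Rightarrow> nat set set \<Rightarrow> nat list" where
  "adj_matrix n E =
     concat (map (\<lambda>u. map (\<lambda>v. if {u, v} \<in> E then 1 else 0) [0..<n]) [0..<n])"

text \<open>Intended for graphs with vertex set \<open>{..<n}\<close>.\<close>

definition encode :: "nat mlgraph \<Rightarrow> nat \<Rightarrow> nat list" where
  "encode G k =
     (let n = card (verts G) in
      [n, length (cop_layers G), k] @ adj_matrix n (robber_layer G) @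
      concat (map (adj_matrix n) (cop_layers G)))"

end

theory Submission
  imports Defs
begin

text \<open>A cop matters only through the component \<open>K\<close> of its layer in which it moves. For \<open>u = v\<close> or an edge
  \<open>{u, v}\<close> of the tree, let a cop contribute 1 if \<open>K\<close> contains \<open>u\<close> or \<open>v\<close>, and 1 more if \<open>K\<close> contains
  both and they are at distance at most 2 in the layer. The cops win iff every such pair receives
  at least 2. If some pair does not, at each moment one of \<open>u\<close> and \<open>v\<close> is out of reach of all cops,
  so the robber survives on \<open>{u, v}\<close>. If all pairs do, a cop guarding \<open>x\<close> confines the robber to the
  branch behind an edge \<open>{x, w}\<close>, and the guard can be advanced to \<open>w\<close>: by another cop covering \<open>w\<close>,
  by a second cop relieving the guard at \<open>x\<close>, or by the guard itself, passing through a common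
  neighbour of \<open>x\<close> and \<open>w\<close>.

  Whether the condition can be met with \<open>k\<close> cops is decided by a bounded search: some cop of any
  solution must cover one of the two vertices of a violated pair, which leaves \<open>2 \<tau>\<close> choices for
  its component, and there are \<open>k\<close> cops, hence \<open>(2 \<tau>) ^ k\<close> branches.\<close>

section \<open>The game on a tree\<close>

text \<open>The condition is local because a robber who can survive at all can survive on one vertex
  or one edge: what the cops need is to threaten both ends of an edge at the same moment. Two cops
  in suitable components can achieve this from afar, a single cop only from a vertex within one step
  of both ends, whence the distance 2. Acyclicity serves the other direction: a robber behind an
  edge cannot get around the guard, and every advance of the guard strictly shrinks its territory.
  The condition is a sum over the cops, so cops can be chosen one after another without fixing the
  allocation beforehand, and a pair short of weight must receive some from a cop still to be placed.
  The machine offers neither multiplication nor division, and its time is counted exactly. The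
  program is therefore written with counting loops, whose time can be bounded from the syntax, and
  products, powers and quotients are obtained by counting.\<close>

definition edge_rel :: "'v set set \<Rightarrow> ('v \<times> 'v) set" where
  "edge_rel E = {(u, v). {u, v} \<in> E}"

definition near :: "'v set set \<Rightarrow> 'v \<Rightarrow> 'v \<Rightarrow> bool" where
  "near E u v \<longleftrightarrow> (\<exists>z. step_along E u z \<and> step_along E v z)"

text \<open>The first summand does not distinguish which end the cop reaches. That each end is
  reached by some cop is enforced by the pairs with \<open>u = v\<close>, on which the weight is 0
  or 2 because \<open>near E u u\<close> always holds.\<close>

definition weight :: "'v set set \<Rightarrow> 'v \<Rightarrow> 'v \<Rightarrow> 'v \<Rightarrow> nat" where
  "weight E x u v =
     (if (x, u) \<in> (edge_rel E)\<^sup>* \<or> (x, v) \<in> (edge_rel E)\<^sup>* then 1 else 0) +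
     (if (x, u) \<in> (edge_rel E)\<^sup>* \<and> (x, v) \<in> (edge_rel E)\<^sup>* \<and> near E u v then 1 else 0)"

definition guarded :: "'v mlgraph \<Rightarrow> nat list \<Rightarrow> (nat \<times> nat \<Rightarrow> 'v) \<Rightarrow> bool" where
  "guarded G ks p \<longleftrightarrow>
     (\<forall>u\<in>verts G. \<forall>v\<in>verts G. u = v \<or> {u, v} \<in> robber_layer G \<longrightarrow>
        2 \<le> (\<Sum>c\<in>cops ks. weight (cop_layers G ! fst c) (p c) u v))"

lemma edge_rel_sym: "(u, v) \<in> edge_rel E \<longleftrightarrow> (v, u) \<in> edge_rel E"
  by (simp add: edge_rel_def insert_commute)

lemma edge_rtrancl_sym: "(u, v) \<in> (edge_rel E)\<^sup>* \<longleftrightarrow> (v, u) \<in> (edge_rel E)\<^sup>*"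
  by (metis edge_rel_sym sym_rtrancl symD symI)

lemma step_along_sym: "step_along E u v \<longleftrightarrow> step_along E v u"
  by (auto simp: step_along_def insert_commute)

lemma step_along_rtrancl: "step_along E u v \<Longrightarrow> (u, v) \<in> (edge_rel E)\<^sup>*"
  by (auto simp: step_along_def edge_rel_def)

lemma finite_cops: "finite (cops ks)"
proof -
  have "cops ks = Sigma {..<length ks} (\<lambda>i. {..<ks ! i})" by (auto simp: cops_def)
  then show ?thesis by simp
qed

section \<open>Components left after deleting a vertex of the tree\<close>

section \<open>Branches of a tree\<close>

text \<open>For \<open>w\<close> adjacent to \<open>x\<close> this is the component of
  \<open>w\<close> after removal of \<open>x\<close>: the territory of a robber shut in by a cop on
  \<open>x\<close>.\<close>

definition branch :: "'v set set \<Rightarrow> 'v \<Rightarrow> 'v \<Rightarrow> 'v set" where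
  "branch E x w = {y. (w, y) \<in> {(a, b). {a, b} \<in> E \<and> a \<noteq> x \<and> b \<noteq> x}\<^sup>*}"

lemma branch_refl: "w \<in> branch E x w"
  by (simp add: branch_def)

lemma branch_not_root: "w \<noteq> x \<Longrightarrow> x \<notin> branch E x w"
  by (auto simp: branch_def elim: rtranclE)

lemma branch_step:
  assumes "w \<noteq> x" "r \<in> branch E x w" "step_along E r r'"
  shows "r' \<in> branch E x w \<or> r' = x"
proof -
  have "r \<noteq> x" using assms branch_not_root by metis
  then show ?thesis using assms unfolding branch_def step_along_def
    by (auto intro: rtrancl_into_rtrancl)
qed

text \<open>Follow the walk from \<open>w\<close>; whenever it returns to \<open>w\<close>, start
  afresh with the next vertex as \<open>v\<close>. The relation \<open>S\<close> is general so that
  the lemma serves both the whole tree and the edges avoiding an old guard post \<open>x\<close>,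
  where it also shows that \<open>v\<close> differs from \<open>x\<close>.\<close>

lemma branch_cases:
  assumes "(w, r) \<in> S\<^sup>*" "S \<subseteq> edge_rel E" "r \<noteq> w"
  obtains v where "(w, v) \<in> S" "v \<noteq> w" "r \<in> branch E w v"
proof -
  have "r = w \<or> (\<exists>v. (w, v) \<in> S \<and> v \<noteq> w \<and> r \<in> branch E w v)"
    using assms(1)
  proof (induction rule: rtrancl_induct)
    case (step y z)
    have e: "{y, z} \<in> E" using step assms(2) by (auto simp: edge_rel_def)
    show ?case
    proof (cases "z = w \<or> y = w")
      case True
      then show ?thesis using step.hyps(2) branch_refl by fastforce
    next
      case False
      then obtain v where v: "(w, v) \<in> S" "v \<noteq> w" "y \<in> branch E w v" using step.IH by blast
      then have "z \<in> branch E w v"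
        using branch_step[OF v(2,3), of z] e False by (auto simp: step_along_def)
      then show ?thesis using v by blast
    qed
  qed auto
  then show thesis using assms(3) that by blast
qed

lemma rtrancl_simple_path:
  assumes "(a, b) \<in> S\<^sup>*"
  shows "\<exists>xs. xs \<noteq> [] \<and> hd xs = a \<and> last xs = b \<and> distinct xs \<and>
           (\<forall>i. Suc i < length xs \<longrightarrow> (xs ! i, xs ! Suc i) \<in> S)"
  using assms
proof (induction rule: converse_rtrancl_induct)
  case base
  show ?case by (intro exI[of _ "[b]"]) auto
next
  case (step a c)
  then obtain xs where xs: "xs \<noteq> []" "hd xs = c" "last xs = b" "distinct xs"
    "\<And>i. Suc i < length xs \<Longrightarrow> (xs ! i, xs ! Suc i) \<in> S" by blast
  show ?case
  proof (cases "a \<in> set xs")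
    case True
    \<comment> \<open>If the new vertex is already on the path, the part from its occurrence onwards
      will do.\<close>
    then obtain k where k: "k < length xs" "xs ! k = a" by (auto simp: in_set_conv_nth)
    show ?thesis
      using k xs by (intro exI[of _ "drop k xs"]) (auto simp: hd_drop_conv_nth)
  next
    case False
    show ?thesis
    proof (intro exI[of _ "a # xs"] conjI allI impI)
      fix i assume "Suc i < length (a # xs)"
      then show "((a # xs) ! i, (a # xs) ! Suc i) \<in> S"
        using xs step.hyps(1) by (cases i) (auto simp: hd_conv_nth)
    qed (use xs False in auto)
  qed
qed

text \<open>A simple path from \<open>v\<close> to \<open>x\<close> avoiding \<open>w\<close> would
  be closed to a cycle by the edges \<open>{x, w}\<close> and \<open>{w, v}\<close>.\<close>

lemma branch_back_edge:
  assumes "\<nexists>xs. is_cycle E xs" "{x, w} \<in> E" "{w, v} \<in> E" "v \<noteq> x" "v \<noteq> w" "x \<noteq> w"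
  shows "x \<notin> branch E w v"
proof
  let ?S = "{(a, b). {a, b} \<in> E \<and> a \<noteq> w \<and> b \<noteq> w}"
  assume "x \<in> branch E w v"
  then obtain xs where xs: "xs \<noteq> []" "hd xs = v" "last xs = x" "distinct xs"
    "\<And>i. Suc i < length xs \<Longrightarrow> (xs ! i, xs ! Suc i) \<in> ?S"
    using rtrancl_simple_path[of v x ?S] unfolding branch_def by blast
  have len: "2 \<le> length xs"
    using xs(1-3) assms(4) by (cases xs; cases "tl xs") auto
  \<comment> \<open>The path has at least two vertices, so each of them lies on one of its edges,
    and these avoid \<open>w\<close>.\<close>
  have "w \<notin> set xs"
  proof
    assume "w \<in> set xs"
    then obtain i where i: "i < length xs" "xs ! i = w" by (auto simp: in_set_conv_nth)
    show False
    proof (cases "Suc i < length xs")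
      case True
      then show False using xs(5)[of i] i by auto
    next
      case False
      then show False using xs(5)[of "i - 1"] i len by auto
    qed
  qed
  moreover have "{(w # xs) ! i, (w # xs) ! Suc i} \<in> E" if "Suc i < length (w # xs)" for i
    using that xs(1,2,5) assms(3) by (cases i) (fastforce simp: hd_conv_nth)+
  ultimately have "is_cycle E (w # xs)"
    using xs len assms(2) unfolding is_cycle_def by auto
  then show False using assms(1) by blast
qed

text \<open>This makes the chase end: when the guard passes from \<open>x\<close> to
  \<open>w\<close>, the robber's branch loses at least \<open>w\<close>.\<close>

lemma branch_psubset:
  assumes "\<nexists>xs. is_cycle E xs" "{x, w} \<in> E" "{w, v} \<in> E" "v \<noteq> x" "v \<noteq> w" "x \<noteq> w"
  shows "branch E w v \<subset> branch E x w"
proof -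
  have *: "x \<notin> branch E w v" using branch_back_edge[OF assms] .
  have "y \<in> branch E x w" if "y \<in> branch E w v" for y
  proof -
    have "(v, y) \<in> {(a, b). {a, b} \<in> E \<and> a \<noteq> w \<and> b \<noteq> w}\<^sup>*" using that by (simp add: branch_def)
    then show ?thesis
    proof (induction rule: rtrancl_induct)
      case base
      show ?case using assms branch_step[OF _ branch_refl, of w x E v] by (auto simp: step_along_def)
    next
      case (step y z)
      have "z \<in> branch E w v"
        using step.hyps unfolding branch_def by (auto intro: rtrancl_into_rtrancl)
      then show ?case using * step branch_step[of w x y E z] assms(6) by (auto simp: step_along_def)
    qed
  qed
  moreover have "w \<notin> branch E w v" using branch_not_root assms(5) by metis
  ultimately show ?thesis using branch_refl[of w E x] by blast
qed

section \<open>Winning positions and the strategies behind them\<close>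

section \<open>Winning positions\<close>

text \<open>Positions with the cops to move. As a least fixed point the predicate admits only plays
  that end in capture, so its induction principle builds strategies.\<close>

inductive winning :: "'v mlgraph \<Rightarrow> nat list \<Rightarrow> (nat \<times> nat \<Rightarrow> 'v) \<Rightarrow> 'v \<Rightarrow> bool" for G ks where
  caught: "c \<in> cops ks \<Longrightarrow> p c = r \<Longrightarrow> winning G ks p r"
| catch: "\<forall>c\<in>cops ks. step_along (cop_layers G ! fst c) (p c) (p' c) \<Longrightarrow>
    c \<in> cops ks \<Longrightarrow> p' c = r \<Longrightarrow> winning G ks p r"
| move: "\<forall>c\<in>cops ks. step_along (cop_layers G ! fst c) (p c) (p' c) \<Longrightarrow>
    (\<And>r'. step_along (robber_layer G) r r' \<Longrightarrow> winning G ks p' r') \<Longrightarrow> winning G ks p r"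

text \<open>The history starts with \<open>r\<close> itself, so the value on \<open>[]\<close> is
  the position before the cops answer the robber on \<open>r\<close>.\<close>

definition winning_strategy_from ::
  "'v mlgraph \<Rightarrow> nat list \<Rightarrow> (nat \<times> nat \<Rightarrow> 'v) \<Rightarrow> 'v \<Rightarrow> 'v cop_strategy \<Rightarrow> bool" where
  "winning_strategy_from G ks p r \<sigma> \<longleftrightarrow>
     \<sigma> [] = p \<and>
     (\<forall>c\<in>cops ks. \<forall>h v. step_along (cop_layers G ! fst c) (\<sigma> h c) (\<sigma> (h @ [v]) c)) \<and>
     (\<forall>\<rho>. \<rho> 0 = r \<longrightarrow> (\<forall>t. step_along (robber_layer G) (\<rho> t) (\<rho> (Suc t))) \<longrightarrow> captures ks \<sigma> \<rho>)"

lemma winning_strategy: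
  "winning G ks p r \<Longrightarrow> \<exists>\<sigma>. winning_strategy_from G ks p r \<sigma>"
proof (induction rule: winning.induct)
  case (caught c p r)
  then show ?case unfolding winning_strategy_from_def captures_def
    by (intro exI[of _ "\<lambda>_. p"]) (auto simp: step_along_def intro!: exI[of _ 0])
next
  case (catch p p' c r)
  then show ?case unfolding winning_strategy_from_def captures_def
    by (intro exI[of _ "\<lambda>h. if h = [] then p else p'"])
       (fastforce simp: step_along_def intro!: exI[of _ 0])
next
  case (move p p' r)
  then obtain S where S: "\<And>r'. step_along (robber_layer G) r r' \<Longrightarrow> winning_strategy_from G ks p' r' (S r')"
    by metis
  \<comment> \<open>From the second robber position on, the first one is forgotten and the strategy
    for the second is followed; both have the cops on \<open>p'\<close> at the switch. If the second
    entry is no legal robber move, the cops stay on \<open>p'\<close>, because legality of the cop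
    moves is demanded on all histories.\<close>
  define \<sigma> where "\<sigma> = (\<lambda>h. if h = [] then p else if tl h = [] then p'
     else if step_along (robber_layer G) r (hd (tl h)) then S (hd (tl h)) (tl h) else p')"
  have "step_along (cop_layers G ! fst c) (\<sigma> h c) (\<sigma> (h @ [v]) c)" if c: "c \<in> cops ks" for c h v
  proof -
    consider "h = []" | a where "h = [a]" | a b h' where "h = a # b # h'"
      by (metis neq_Nil_conv)
    then show ?thesis
    proof cases
      case 1
      then show ?thesis using move c by (simp add: \<sigma>_def)
    next
      case 2
      show ?thesis
      proof (cases "step_along (robber_layer G) r v")
        case True
        then have "step_along (cop_layers G ! fst c) (S v [] c) (S v ([] @ [v]) c)" "S v [] = p'"
          using S c unfolding winning_strategy_from_def by blast+
        then show ?thesis using True 2 by (simp add: \<sigma>_def)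
      qed (simp add: 2 \<sigma>_def step_along_def)
    next
      case 3
      show ?thesis
      proof (cases "step_along (robber_layer G) r b")
        case True
        then have "step_along (cop_layers G ! fst c) (S b (b # h') c) (S b ((b # h') @ [v]) c)"
          using S c unfolding winning_strategy_from_def by blast
        then show ?thesis using True 3 by (simp add: \<sigma>_def)
      qed (simp add: 3 \<sigma>_def step_along_def)
    qed
  qed
  moreover have "captures ks \<sigma> \<rho>"
    if \<rho>: "\<rho> 0 = r" "\<And>t. step_along (robber_layer G) (\<rho> t) (\<rho> (Suc t))" for \<rho>
  proof -
    let ?\<rho> = "\<lambda>t. \<rho> (Suc t)"
    have st: "step_along (robber_layer G) r (?\<rho> 0)" using \<rho> by metis
    have "captures ks (S (?\<rho> 0)) ?\<rho>"
      using S[OF st] \<rho> unfolding winning_strategy_from_def by auto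
    \<comment> \<open>Shifting the history by one turns either kind of capture at time
      \<open>t\<close> by the later strategy into a capture at time \<open>t + 1\<close>.\<close>
    moreover have "\<sigma> (map \<rho> [0..<Suc t]) = S (?\<rho> 0) (map ?\<rho> [0..<t])" for t
    proof (cases t)
      case 0
      then show ?thesis using S[OF st] by (auto simp: \<sigma>_def winning_strategy_from_def)
    next
      case (Suc t')
      have "map \<rho> [0..<Suc t] = \<rho> 0 # map ?\<rho> [0..<t]"
        by (simp add: upt_conv_Cons map_Suc_upt[symmetric] del: upt_Suc)
      moreover have "map ?\<rho> [0..<t] = ?\<rho> 0 # map ?\<rho> [1..<t]"
        using Suc by (simp add: upt_conv_Cons del: upt_Suc)
      ultimately show ?thesis using st by (simp add: \<sigma>_def)
    qed
    ultimately show ?thesis unfolding captures_def by metis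
  qed
  ultimately show ?case
    unfolding winning_strategy_from_def by (intro exI[of _ \<sigma>]) (simp add: \<sigma>_def)
qed

text \<open>Before the robber appears, the strategies for all its starting vertices agree on
  \<open>p\<close>, so they can be glued along the first entry of the history.\<close>

lemma cops_win_if_winning:
  assumes "\<And>c. c \<in> cops ks \<Longrightarrow> p c \<in> verts G" "\<And>r. r \<in> verts G \<Longrightarrow> winning G ks p r"
  shows "cops_win G ks"
proof -
  obtain S where S: "\<And>r. r \<in> verts G \<Longrightarrow> winning_strategy_from G ks p r (S r)"
    using winning_strategy assms(2) by metis
  define \<sigma> where "\<sigma> = (\<lambda>h. if h = [] then p else if hd h \<in> verts G then S (hd h) h else p)"
  have "step_along (cop_layers G ! fst c) (\<sigma> h c) (\<sigma> (h @ [v]) c)" if c: "c \<in> cops ks" for c h v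
  proof (cases "h = []")
    case True
    show ?thesis
    proof (cases "v \<in> verts G")
      case True
      then have "step_along (cop_layers G ! fst c) (S v [] c) (S v ([] @ [v]) c)" "S v [] = p"
        using S c unfolding winning_strategy_from_def by blast+
      then show ?thesis using True \<open>h = []\<close> by (simp add: \<sigma>_def)
    qed (simp add: True \<sigma>_def step_along_def)
  next
    case False
    show ?thesis
    proof (cases "hd h \<in> verts G")
      case True
      then have "step_along (cop_layers G ! fst c) (S (hd h) h c) (S (hd h) (h @ [v]) c)"
        using S c unfolding winning_strategy_from_def by blast
      then show ?thesis using True False by (simp add: \<sigma>_def)
    qed (simp add: False \<sigma>_def step_along_def)
  qed
  then have "legal_cop_strategy G ks \<sigma>"
    using assms(1) unfolding legal_cop_strategy_def by (fastforce simp: \<sigma>_def)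
  moreover have "captures ks \<sigma> \<rho>" if "robber_play G \<rho>" for \<rho>
  proof -
    have r: "\<rho> 0 \<in> verts G" using that by (simp add: robber_play_def)
    have "captures ks (S (\<rho> 0)) \<rho>"
      using S[OF r] that unfolding winning_strategy_from_def robber_play_def by auto
    moreover have "\<sigma> (map \<rho> [0..<t]) = S (\<rho> 0) (map \<rho> [0..<t])" for t
      using S[OF r] r by (cases t) (auto simp: \<sigma>_def winning_strategy_from_def upt_conv_Cons simp del: upt_Suc)
    ultimately show ?thesis unfolding captures_def by metis
  qed
  ultimately show ?thesis unfolding cops_win_def by blast
qed

text \<open>While cop \<open>j\<close> walks to \<open>y\<close> inside its component, cop
  \<open>i\<close> waits on \<open>x\<close>. The robber can leave \<open>B\<close> only through
  \<open>x\<close>, where it is caught, so \<open>B\<close> remains its prison however long the walk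
  takes.\<close>

lemma winning_transport:
  assumes "(a, y) \<in> (edge_rel (cop_layers G ! fst j))\<^sup>*" "p j = a"
    and "i \<in> cops ks" "j \<in> cops ks" "i \<noteq> j" "p i = x"
    and "\<And>r r'. r \<in> B \<Longrightarrow> step_along (robber_layer G) r r' \<Longrightarrow> r' \<in> B \<or> r' = x"
    and "\<And>r. r \<in> B \<Longrightarrow> winning G ks (p(j := y)) r" "r \<in> B"
  shows "winning G ks p r"
  using assms
proof (induction arbitrary: p r rule: converse_rtrancl_induct)
  case base
  have "p(j := y) = p" using base.prems(1) fun_upd_triv by metis
  moreover have "winning G ks (p(j := y)) r" using base.prems(7,8) by blast
  ultimately show ?case by (simp only:)
next
  case (step a b)
  show ?case
  proof (rule winning.move)
    show "\<forall>c\<in>cops ks. step_along (cop_layers G ! fst c) (p c) ((p(j := b)) c)"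
      using step.hyps(1) step.prems(1) by (auto simp: step_along_def edge_rel_def)
    fix r' assume r': "step_along (robber_layer G) r r'"
    show "winning G ks (p(j := b)) r'"
    proof (cases "r' = x")
      case True
      then show ?thesis using step.prems by (intro winning.caught[of i]) auto
    next
      case False
      then have "r' \<in> B" using step.prems(6)[OF step.prems(8) r'] by blast
      show ?thesis
      proof (rule step.IH)
        show "winning G ks ((p(j := b))(j := y)) r" if "r \<in> B" for r
          using step.prems(7)[OF that] by (simp only: fun_upd_upd)
      qed (use step.prems \<open>r' \<in> B\<close> in auto)
    qed
  qed
qed

lemma two_le_sumD:
  fixes f :: "'a \<Rightarrow> nat"
  assumes "finite A" "2 \<le> sum f A" "i \<in> A" "\<And>j. j \<in> A \<Longrightarrow> j \<noteq> i \<Longrightarrow> f j = 0"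
  shows "2 \<le> f i"
proof -
  have "sum f A = f i + sum f (A - {i})" using assms by (simp add: sum.remove)
  moreover have "sum f (A - {i}) = 0" using assms by auto
  ultimately show ?thesis using assms by linarith
qed

text \<open>The condition is known for the placement \<open>p0\<close>; it stays usable in the
  present position \<open>p\<close> because every cop is still in its original component. Each case
  brings a cop to \<open>w\<close> without letting the robber escape past \<open>x\<close>, after
  which the branch to be searched is smaller.\<close>

lemma winning_branch:
  assumes V: "multilayer_graph G" "is_tree (verts G) (robber_layer G)"
    and g: "guarded G ks p0"
    and "i \<in> cops ks" "p i = x" "{x, w} \<in> robber_layer G" "r \<in> branch (robber_layer G) x w"
    and "\<And>c. c \<in> cops ks \<Longrightarrow> (p0 c, p c) \<in> (edge_rel (cop_layers G ! fst c))\<^sup>*"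
  shows "winning G ks p r"
  using assms(4-)
proof (induction "card (branch (robber_layer G) x w)" arbitrary: i p x w r rule: less_induct)
  case less
  let ?R = "robber_layer G"
  let ?D = "\<lambda>c. (edge_rel (cop_layers G ! fst c))\<^sup>*"
  have edge: "u \<noteq> v \<and> u \<in> verts G \<and> v \<in> verts G" if "{u, v} \<in> ?R" for u v
  proof -
    have "card {u, v} = 2 \<and> {u, v} \<subseteq> verts G"
      using that V(1) unfolding multilayer_graph_def is_layer_def by blast
    then show ?thesis by (auto simp: card_insert_if split: if_splits)
  qed
  have acyc: "\<nexists>xs. is_cycle ?R xs" using V(2) by (simp add: is_tree_def)
  have xw: "w \<noteq> x" "x \<in> verts G" "w \<in> verts G" using edge[OF less.prems(3)] by auto
  have bstep: "r' \<in> branch ?R x w \<or> r' = x" if "r \<in> branch ?R x w" "step_along ?R r r'" for r r'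
    using branch_step[OF xw(1) that] .
  have fin: "finite (branch ?R x w)"
  proof (rule finite_subset)
    have "y \<in> verts G" if "(w, y) \<in> {(a, b). {a, b} \<in> ?R \<and> a \<noteq> x \<and> b \<noteq> x}\<^sup>*" for y
      using that xw(3) edge by (induction) auto
    then show "branch ?R x w \<subseteq> verts G" by (auto simp: branch_def)
  qed (use V(1) in \<open>simp add: multilayer_graph_def\<close>)
  \<comment> \<open>With a cop on \<open>w\<close>, the robber is either caught there or sits behind
    an edge from \<open>w\<close> to some \<open>v\<close> other than \<open>x\<close>, where the
    induction hypothesis applies.\<close>
  have advance: "winning G ks p' r'"
    if at: "j \<in> cops ks" "p' j = w" "r' \<in> branch ?R x w" "\<And>c. c \<in> cops ks \<Longrightarrow> (p0 c, p' c) \<in> ?D c" for j p' r'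
  proof (cases "r' = w")
    case True
    then show ?thesis using at by (intro winning.caught) auto
  next
    case False
    then obtain v where v: "{w, v} \<in> ?R" "v \<noteq> x" "v \<noteq> w" "r' \<in> branch ?R w v"
      using branch_cases[of w r' "{(a, b). {a, b} \<in> ?R \<and> a \<noteq> x \<and> b \<noteq> x}" ?R] at(3)
      by (auto simp: branch_def edge_rel_def)
    have "branch ?R w v \<subset> branch ?R x w"
      using branch_psubset[OF acyc less.prems(3) v(1-3)] xw by auto
    then have "card (branch ?R w v) < card (branch ?R x w)" using fin by (simp add: psubset_card_mono)
    from less.hyps[OF this at(1,2) v(1,4) at(4)] show ?thesis .
  qed
  have reach: "(p c, y) \<in> ?D c" if "c \<in> cops ks" "(p0 c, y) \<in> ?D c" for c y
    using less.prems(5)[OF that(1)] that(2) edge_rtrancl_sym rtrancl_trans by metis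
  have upd: "(p0 c, (p(j := y)) c) \<in> ?D c" if "c \<in> cops ks" "(p0 j, y) \<in> ?D j" for c j y
    using that less.prems(5) by auto
  \<comment> \<open>If no other cop reaches \<open>w\<close>, the guard itself must, by the pair
    \<open>(w, w)\<close>. Then either another cop can take over at \<open>x\<close>, or the guard
    alone has weight on \<open>(x, w)\<close>.\<close>
  consider (other) j where "j \<in> cops ks" "j \<noteq> i" "(p0 j, w) \<in> ?D j"
    | (relieve) j where "j \<in> cops ks" "j \<noteq> i" "(p0 j, x) \<in> ?D j" "(p0 i, w) \<in> ?D i"
    | (only) "\<And>j. j \<in> cops ks \<Longrightarrow> j \<noteq> i \<Longrightarrow> (p0 j, w) \<notin> ?D j \<and> (p0 j, x) \<notin> ?D j"
    | (none) "\<And>j. j \<in> cops ks \<Longrightarrow> (p0 j, w) \<notin> ?D j"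
    by metis
  then show ?case
  proof cases
    case other
    show ?thesis
    proof (rule winning_transport[where j = j and y = w and i = i and x = x])
      show "winning G ks (p(j := w)) r" if "r \<in> branch ?R x w" for r
        using advance[of j "p(j := w)" r] that other upd by auto
    qed (use other less.prems reach bstep in auto)
  next
    case relieve
    show ?thesis
    proof (rule winning_transport[where j = j and y = x and i = i and x = x])
      fix r assume r: "r \<in> branch ?R x w"
      show "winning G ks (p(j := x)) r"
      proof (rule winning_transport[where j = i and y = w and i = j and x = x])
        show "winning G ks (p(j := x, i := w)) r" if "r \<in> branch ?R x w" for r
          using advance[of i "p(j := x, i := w)" r] that relieve less.prems by auto
      qed (use relieve less.prems reach[of i w] bstep r in auto)
    qed (use relieve less.prems reach bstep in auto)
  next
    case none
    have "(\<Sum>c\<in>cops ks. weight (cop_layers G ! fst c) (p0 c) w w) = 0"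
      using none by (auto simp: weight_def finite_cops)
    then show ?thesis using g xw(3) unfolding guarded_def by fastforce
  next
    case only
    have "2 \<le> (\<Sum>c\<in>cops ks. weight (cop_layers G ! fst c) (p0 c) x w)"
      using g xw less.prems(3) unfolding guarded_def by blast
    then have "2 \<le> weight (cop_layers G ! fst i) (p0 i) x w"
      by (rule two_le_sumD[OF finite_cops _ less.prems(1)]) (use only in \<open>auto simp: weight_def\<close>)
    then have "(p0 i, w) \<in> ?D i" "near (cop_layers G ! fst i) x w"
      by (auto simp: weight_def split: if_splits)
    then obtain z where z: "step_along (cop_layers G ! fst i) x z" "step_along (cop_layers G ! fst i) z w"
      by (auto simp: near_def step_along_sym)
    \<comment> \<open>On \<open>z\<close> the guard threatens \<open>x\<close> and \<open>w\<close>
      at once. Even if neither is occupied for one round, the robber can step on neither without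
      being caught by the next cop move.\<close>
    show ?thesis
    proof (rule winning.move[of _ _ _ "p(i := z)"])
      show "\<forall>c\<in>cops ks. step_along (cop_layers G ! fst c) (p c) ((p(i := z)) c)"
        using z less.prems(2) by (auto simp: step_along_def)
      fix r' assume r': "step_along ?R r r'"
      then consider "r' = x" | "r' = w" | "r' \<noteq> w" "r' \<in> branch ?R x w" using bstep less.prems(4) by blast
      then show "winning G ks (p(i := z)) r'"
      proof cases
        case 1
        then show ?thesis using z less.prems
          by (intro winning.catch[of _ _ _ "p(i := x)" i]) (auto simp: step_along_def insert_commute)
      next
        case 2
        then show ?thesis using z less.prems
          by (intro winning.catch[of _ _ _ "p(i := w)" i]) (auto simp: step_along_def)
      next
        case 3
        then obtain v where v: "{w, v} \<in> ?R" "v \<noteq> x" "v \<noteq> w" "r' \<in> branch ?R w v"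
          using branch_cases[of w r' "{(a, b). {a, b} \<in> ?R \<and> a \<noteq> x \<and> b \<noteq> x}" ?R]
          by (auto simp: branch_def edge_rel_def)
        have sub: "branch ?R w v \<subset> branch ?R x w"
          using branch_psubset[OF acyc less.prems(3) v(1-3)] xw by auto
        show ?thesis
        proof (rule winning.move[of _ _ _ "p(i := w)"])
          show "\<forall>c\<in>cops ks. step_along (cop_layers G ! fst c) ((p(i := z)) c) ((p(i := w)) c)"
            using z by (auto simp: step_along_def)
          fix r'' assume "step_along ?R r' r''"
          then have "r'' \<in> branch ?R w v \<or> r'' = w" using branch_step v by metis
          then have "r'' \<in> branch ?R x w" using sub branch_refl[of w] by auto
          then show "winning G ks (p(i := w)) r''"
            using advance[of i "p(i := w)"] less.prems(1) upd[OF _ \<open>(p0 i, w) \<in> ?D i\<close>] by auto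
        qed
      qed
    qed
  qed
qed

lemma guarded_imp_cops_win:
  assumes V: "multilayer_graph G" "is_tree (verts G) (robber_layer G)"
    and g: "guarded G ks p" and p: "\<And>c. c \<in> cops ks \<Longrightarrow> p c \<in> verts G"
  shows "cops_win G ks"
proof -
  let ?D = "\<lambda>c. (edge_rel (cop_layers G ! fst c))\<^sup>*"
  obtain x where x: "x \<in> verts G" using V(2) by (auto simp: is_tree_def connected_graph_def)
  have "\<exists>i\<in>cops ks. (p i, x) \<in> ?D i"
  proof (rule ccontr)
    assume "\<not> ?thesis"
    then have "(\<Sum>c\<in>cops ks. weight (cop_layers G ! fst c) (p c) x x) = 0"
      by (auto simp: weight_def finite_cops)
    then show False using g x unfolding guarded_def by fastforce
  qed
  then obtain i where i: "i \<in> cops ks" "(p i, x) \<in> ?D i" by blast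
  \<comment> \<open>Placement is free, so the first guard starts on \<open>x\<close> at once;
    \<open>guarded\<close> is still invoked for the old placement \<open>p\<close>.\<close>
  let ?p = "p(i := x)"
  show ?thesis
  proof (rule cops_win_if_winning[of ks ?p])
    show "?p c \<in> verts G" if "c \<in> cops ks" for c using that p x by auto
    fix r assume r: "r \<in> verts G"
    show "winning G ks ?p r"
    proof (cases "r = x")
      case True
      then show ?thesis using i by (intro winning.caught[of i]) auto
    next
      case False
      have "(x, r) \<in> (edge_rel (robber_layer G))\<^sup>*"
        using V(2) x r unfolding is_tree_def connected_graph_def edge_rel_def by blast
      from branch_cases[OF this subset_refl False]
      obtain w where w: "{x, w} \<in> robber_layer G" "r \<in> branch (robber_layer G) x w"
        by (auto simp: edge_rel_def)
      show ?thesis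
        by (rule winning_branch[OF V g i(1) _ w]) (use i in auto)
    qed
  qed
qed

text \<open>Cops never leave the components of their initial positions, so the initial weights limit
  all later threats: threatening both ends at once takes two cops of weight at least 1 or one cop of
  weight 2.\<close>

lemma cops_win_imp_guarded:
  assumes "legal_cop_strategy G ks \<sigma>" "\<And>r. robber_play G r \<Longrightarrow> captures ks \<sigma> r"
  shows "guarded G ks (\<sigma> [])"
  unfolding guarded_def
proof (intro ballI impI, rule ccontr)
  fix u v
  let ?L = "\<lambda>c. cop_layers G ! fst c"
  let ?D = "\<lambda>c. (edge_rel (?L c))\<^sup>*"
  let ?wt = "\<lambda>c. weight (?L c) (\<sigma> [] c) u v"
  assume uv: "u \<in> verts G" "v \<in> verts G" "u = v \<or> {u, v} \<in> robber_layer G" and "\<not> 2 \<le> sum ?wt (cops ks)"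
  then have small: "sum ?wt (cops ks) < 2" by simp
  have legal: "step_along (?L c) (\<sigma> h c) (\<sigma> (h @ [x]) c)" if "c \<in> cops ks" for c h x
    using assms(1) that unfolding legal_cop_strategy_def by (cases c) auto
  have stay: "(\<sigma> [] c, \<sigma> h c) \<in> ?D c" if "c \<in> cops ks" for c h
  proof (induction h rule: rev_induct)
    case (snoc x h)
    then show ?case using step_along_rtrancl[OF legal[OF that, of h x]] by (rule rtrancl_trans)
  qed simp
  have "\<exists>y\<in>{u, v}. \<forall>c\<in>cops ks. \<not> step_along (?L c) (\<sigma> h c) y" for h
  proof (rule ccontr)
    assume "\<not> ?thesis"
    then obtain c c' where c: "c \<in> cops ks" "step_along (?L c) (\<sigma> h c) u"
      "c' \<in> cops ks" "step_along (?L c') (\<sigma> h c') v" by auto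
    then have r: "(\<sigma> [] c, u) \<in> ?D c" "(\<sigma> [] c', v) \<in> ?D c'"
      using stay step_along_rtrancl rtrancl_trans by metis+
    then have pos: "1 \<le> ?wt c" "1 \<le> ?wt c'" by (auto simp: weight_def)
    show False
    proof (cases "c = c'")
      case True
      then have "near (?L c) u v" using c unfolding near_def by (metis step_along_sym)
      then have "?wt c = 2" using r True by (simp add: weight_def)
      moreover have "?wt c \<le> sum ?wt (cops ks)" using c(1) finite_cops by (intro member_le_sum) auto
      ultimately show False using small by simp
    next
      case False
      then have "sum ?wt {c, c'} = ?wt c + ?wt c'" by simp
      moreover have "sum ?wt {c, c'} \<le> sum ?wt (cops ks)"
        using c finite_cops by (intro sum_mono2) auto
      ultimately show False using small pos by linarith
    qed
  qed
  then obtain esc where esc: "\<And>h. esc h \<in> {u, v}" "\<And>h c. c \<in> cops ks \<Longrightarrow> \<not> step_along (?L c) (\<sigma> h c) (esc h)"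
    by metis
  \<comment> \<open>Cop positions are a function of the robber's history, so the escape vertex is
    one too, and iterating \<open>esc\<close> produces the whole play.\<close>
  define hist where "hist = rec_nat [] (\<lambda>_ h. h @ [esc h])"
  define r where "r = (\<lambda>t. esc (hist t))"
  have hist: "map r [0..<t] = hist t" for t
    by (induction t) (auto simp: hist_def r_def)
  have "robber_play G r"
    unfolding robber_play_def
  proof
    show "r 0 \<in> verts G" using esc(1) uv by (metis insertE r_def singletonD)
    show "\<forall>t. step_along (robber_layer G) (r t) (r (Suc t))"
    proof
      fix t
      have "r t \<in> {u, v}" "r (Suc t) \<in> {u, v}" using esc(1) by (simp_all add: r_def)
      then show "step_along (robber_layer G) (r t) (r (Suc t))"
        using uv(3) by (auto simp: step_along_def insert_commute)
    qed
  qed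
  then obtain t c where c: "c \<in> cops ks" "\<sigma> (hist t) c = r t \<or> \<sigma> (hist t @ [r t]) c = r t"
    using assms(2)[of r] unfolding captures_def by (auto simp: hist)
  \<comment> \<open>Since \<open>step_along\<close> includes standing still, it covers capture
    before as well as after the cop move.\<close>
  then have "step_along (?L c) (\<sigma> (hist t) c) (r t)"
    using legal[OF c(1), of "hist t" "r t"] by (auto simp: step_along_def)
  then show False using esc(2)[OF c(1)] by (simp add: r_def)
qed

theorem cops_win_iff_guarded:
  assumes "multilayer_graph G" "is_tree (verts G) (robber_layer G)"
  shows "cops_win G ks \<longleftrightarrow> (\<exists>p. (\<forall>c\<in>cops ks. p c \<in> verts G) \<and> guarded G ks p)"
proof
  assume "cops_win G ks"
  then obtain \<sigma> where s: "legal_cop_strategy G ks \<sigma>" "\<And>r. robber_play G r \<Longrightarrow> captures ks \<sigma> r"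
    unfolding cops_win_def by blast
  then have "guarded G ks (\<sigma> [])" by (rule cops_win_imp_guarded)
  moreover have "\<forall>c\<in>cops ks. \<sigma> [] c \<in> verts G" using s(1) by (auto simp: legal_cop_strategy_def)
  ultimately show "\<exists>p. (\<forall>c\<in>cops ks. p c \<in> verts G) \<and> guarded G ks p" by blast
qed (use guarded_imp_cops_win[OF assms] in blast)

section \<open>Lists of cops and the branching search\<close>

section \<open>Bounded search\<close>

text \<open>The entries with first component \<open>i\<close> are the cops on layer
  \<open>i\<close>, so allocation and placement are searched for together as one list.\<close>

definition score :: "'v mlgraph \<Rightarrow> (nat \<times> 'v) list \<Rightarrow> 'v \<Rightarrow> 'v \<Rightarrow> nat" where
  "score G cs u v = (\<Sum>(l, x)\<leftarrow>cs. weight (cop_layers G ! l) x u v)"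

definition exposed :: "'v mlgraph \<Rightarrow> (nat \<times> 'v) list \<Rightarrow> 'v \<Rightarrow> 'v \<Rightarrow> bool" where
  "exposed G cs u v \<longleftrightarrow> (u = v \<or> {u, v} \<in> robber_layer G) \<and> score G cs u v < 2"

definition safe :: "'v mlgraph \<Rightarrow> (nat \<times> 'v) list \<Rightarrow> bool" where
  "safe G cs \<longleftrightarrow> (\<forall>u\<in>verts G. \<forall>v\<in>verts G. \<not> exposed G cs u v)"

definition placement :: "'v mlgraph \<Rightarrow> (nat \<times> 'v) list \<Rightarrow> bool" where
  "placement G cs \<longleftrightarrow> set cs \<subseteq> {..<length (cop_layers G)} \<times> verts G"

lemma score_simps [simp]:
  "score G [] u v = 0"
  "score G (c # cs) u v = weight (cop_layers G ! fst c) (snd c) u v + score G cs u v"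
  "score G (cs @ cs') u v = score G cs u v + score G cs' u v"
  by (auto simp: score_def case_prod_beta)

lemma safe_append: "safe G cs \<Longrightarrow> safe G (cs @ cs')"
  by (force simp: safe_def exposed_def)

lemma sum_list_filter_keys:
  fixes f :: "nat \<times> 'a \<Rightarrow> nat"
  assumes "fst ` set cs \<subseteq> {..<m}"
  shows "(\<Sum>i<m. \<Sum>c\<leftarrow>filter (\<lambda>c. fst c = i) cs. f c) = sum_list (map f cs)"
  using assms
proof (induction cs)
  case (Cons c cs)
  have "(\<Sum>i<m. \<Sum>c\<leftarrow>filter (\<lambda>c. fst c = i) (c # cs). f c)
      = (\<Sum>i<m. (if fst c = i then f c else 0) + (\<Sum>c\<leftarrow>filter (\<lambda>c. fst c = i) cs. f c))"
    by (intro sum.cong) auto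
  then show ?case using Cons by (simp add: sum.distrib)
qed simp

lemma sum_cops: "(\<Sum>c\<in>cops ks. f c) = (\<Sum>i<length ks. \<Sum>j<ks ! i. f (i, j))"
proof -
  have "cops ks = Sigma {..<length ks} (\<lambda>i. {..<ks ! i})" by (auto simp: cops_def)
  then show ?thesis by (simp add: sum.Sigma)
qed

lemma sum_list_concat: "sum_list (concat xss) = sum_list (map sum_list xss)"
  for xss :: "nat list list"
  by (induction xss) auto

text \<open>Up to the order of the cops, a list is the same as an allocation with a placement: the
  \<open>j\<close>-th entry among those of layer \<open>i\<close> plays cop \<open>(i, j)\<close>,
  and the total weights are one sum grouped in two ways.\<close>

lemma multilayer_iff_safe:
  assumes "multilayer_graph G" "is_tree (verts G) (robber_layer G)"
  shows "multilayer_cops_and_robber G k \<longleftrightarrow> (\<exists>cs. length cs = k \<and> placement G cs \<and> safe G cs)"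
proof
  assume "multilayer_cops_and_robber G k"
  then obtain ks p where ks: "length ks = length (cop_layers G)" "sum_list ks = k"
    and p: "\<forall>c\<in>cops ks. p c \<in> verts G" "guarded G ks p"
    unfolding multilayer_cops_and_robber_def cops_win_iff_guarded[OF assms] by blast
  define cs where "cs = concat (map (\<lambda>i. map (\<lambda>j. (i, p (i, j))) [0..<ks ! i]) [0..<length ks])"
  have "length cs = k"
    using ks(2) by (simp add: cs_def length_concat comp_def map_nth)
  moreover have "placement G cs"
    using p(1) ks(1) by (auto simp: placement_def cs_def cops_def)
  moreover have "score G cs u v = (\<Sum>c\<in>cops ks. weight (cop_layers G ! fst c) (p c) u v)" for u v
    unfolding sum_cops score_def cs_def
    by (simp add: map_concat sum_list_concat comp_def interv_sum_list_conv_sum_set_nat atLeast0LessThan)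
  then have "safe G cs" using p(2) by (fastforce simp: safe_def exposed_def guarded_def)
  ultimately show "\<exists>cs. length cs = k \<and> placement G cs \<and> safe G cs" by blast
next
  assume "\<exists>cs. length cs = k \<and> placement G cs \<and> safe G cs"
  then obtain cs where cs: "length cs = k" "placement G cs" "safe G cs" by blast
  let ?\<tau> = "length (cop_layers G)"
  let ?F = "\<lambda>i. filter (\<lambda>c. fst c = i) cs"
  define ks where "ks = map (\<lambda>i. length (?F i)) [0..<?\<tau>]"
  define p where "p = (\<lambda>(i, j). snd (?F i ! j))"
  have keys: "fst ` set cs \<subseteq> {..<?\<tau>}" using cs(2) by (auto simp: placement_def)
  have "sum_list ks = (\<Sum>i<?\<tau>. \<Sum>c\<leftarrow>?F i. 1)"
    by (simp add: ks_def interv_sum_list_conv_sum_set_nat atLeast0LessThan sum_list_triv)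
  then have "sum_list ks = k" using sum_list_filter_keys[OF keys, of "\<lambda>_. 1"] cs(1) by (simp add: sum_list_triv)
  moreover have F: "?F i ! j \<in> set (?F i)" if "(i, j) \<in> cops ks" for i j
    using that by (intro nth_mem) (auto simp: cops_def ks_def)
  then have "p c \<in> verts G" if "c \<in> cops ks" for c
    using that cs(2) unfolding placement_def p_def by (cases c) fastforce
  moreover have "score G cs u v = (\<Sum>c\<in>cops ks. weight (cop_layers G ! fst c) (p c) u v)" for u v
  proof -
    let ?w = "\<lambda>c. weight (cop_layers G ! fst c) (snd c) u v"
    have "score G cs u v = (\<Sum>i<?\<tau>. \<Sum>c\<leftarrow>?F i. ?w c)"
      using sum_list_filter_keys[OF keys, of ?w] by (simp add: score_def split_def)
    also have "\<dots> = (\<Sum>i<?\<tau>. \<Sum>j<length (?F i). ?w (?F i ! j))"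
      by (simp add: sum_list_sum_nth atLeast0LessThan)
    also have "\<dots> = (\<Sum>i<?\<tau>. \<Sum>j<length (?F i). weight (cop_layers G ! i) (p (i, j)) u v)"
    proof (intro sum.cong refl)
      fix i j assume "i \<in> {..<?\<tau>}" "j \<in> {..<length (?F i)}"
      then have "?F i ! j \<in> set (?F i)" by (intro nth_mem) auto
      then show "?w (?F i ! j) = weight (cop_layers G ! i) (p (i, j)) u v" by (auto simp: p_def)
    qed
    finally show ?thesis by (simp add: sum_cops ks_def)
  qed
  then have "guarded G ks p" using cs(3) by (fastforce simp: safe_def exposed_def guarded_def)
  ultimately show "multilayer_cops_and_robber G k"
    unfolding multilayer_cops_and_robber_def cops_win_iff_guarded[OF assms]
    by (intro exI[of _ ks] conjI exI[of _ p]) (auto simp: ks_def)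
qed

text \<open>Two nested folds, so that two nested program loops match it step by step; later exposed
  pairs overwrite earlier ones. The first component tells a found pair \<open>(0, 0)\<close> from
  the default.\<close>

definition scan :: "nat mlgraph \<Rightarrow> nat \<Rightarrow> (nat \<times> nat) list \<Rightarrow> nat \<times> nat \<times> nat" where
  "scan G n cs =
     fold (\<lambda>u. fold (\<lambda>v r. if exposed G cs u v then (1, u, v) else r) [0..<n]) [0..<n] (0, 0, 0)"

text \<open>The digit \<open>d\<close> encodes a layer and one end of the pair. If nothing is
  exposed, the default of \<open>scan\<close> puts the cop on vertex 0; this is harmless and keeps
  the length equal to the number of steps.\<close>

definition extend :: "nat mlgraph \<Rightarrow> nat \<Rightarrow> (nat \<times> nat) list \<Rightarrow> nat \<Rightarrow> (nat \<times> nat) list" where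
  "extend G n cs d =
     (let \<tau> = length (cop_layers G); (_, u, v) = scan G n cs in
      cs @ [if d < \<tau> then (d, u) else (d - \<tau>, v)])"

text \<open>The digits of \<open>q\<close> in base \<open>b\<close>, lowest first, are the decisions
  along one branch of the search tree, so a loop over numbers replaces backtracking.\<close>

primrec grow :: "nat mlgraph \<Rightarrow> nat \<Rightarrow> nat \<Rightarrow> nat \<Rightarrow> (nat \<times> nat) list" where
  "grow G n q 0 = []"
| "grow G n q (Suc j) =
     (let b = 2 * length (cop_layers G) in extend G n (grow G n q j) (q div b ^ j mod b))"

lemma scan_cases:
  obtains (none) "scan G n cs = (0, 0, 0)" "\<And>u v. u < n \<Longrightarrow> v < n \<Longrightarrow> \<not> exposed G cs u v"
  | (some) u v where "scan G n cs = (1, u, v)" "u < n" "v < n" "exposed G cs u v"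
proof -
  let ?ok = "\<lambda>S r. (r = (0, 0, 0) \<and> (\<forall>(u, v)\<in>S. \<not> exposed G cs u v)) \<or>
    (\<exists>u v. r = (1, u, v) \<and> u < n \<and> v < n \<and> exposed G cs u v)"
  let ?f = "\<lambda>u v r. if exposed G cs u v then (1, u, v) else r"
  \<comment> \<open>The set \<open>S\<close> of pairs examined before is arbitrary, so that each row
    can be appended to the rows preceding it.\<close>
  have inner: "?ok (S \<union> {u} \<times> {..<m}) (fold (?f u) [0..<m] r)"
    if "?ok S r" "u < n" "m \<le> n" for S r u m
    using that(3)
  proof (induction m)
    case 0
    then show ?case using that(1) by simp
  next
    case (Suc m)
    then have "?ok (S \<union> {u} \<times> {..<m}) (fold (?f u) [0..<m] r)" by simp
    moreover have "S \<union> {u} \<times> {..<Suc m} = insert (u, m) (S \<union> {u} \<times> {..<m})" by auto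
    ultimately show ?case using Suc.prems that(2) by simp
  qed
  have "?ok ({..<m} \<times> {..<n}) (fold (\<lambda>u. fold (?f u) [0..<n]) [0..<m] (0, 0, 0))" if "m \<le> n" for m
    using that
  proof (induction m)
    case (Suc m)
    have "{..<Suc m} \<times> {..<n} = {..<m} \<times> {..<n} \<union> {m} \<times> {..<n}" by auto
    then show ?case using inner[OF Suc.IH, of m n] Suc.prems by simp
  qed simp
  from this[OF order_refl] have "?ok ({..<n} \<times> {..<n}) (scan G n cs)" unfolding scan_def .
  then show thesis using none some by auto
qed

lemma scan_safe_iff:
  "verts G = {..<n} \<Longrightarrow> fst (scan G n cs) = 0 \<longleftrightarrow> safe G cs"
  by (cases rule: scan_cases[of G n cs]) (auto simp: safe_def)

lemma length_grow [simp]: "length (grow G n q j) = j"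
  by (induction j) (auto simp: extend_def Let_def case_prod_beta)

lemma placement_extend:
  assumes "verts G = {..<n}" "0 < n" "placement G cs" "d < 2 * length (cop_layers G)"
  shows "placement G (extend G n cs d)"
  using assms by (cases rule: scan_cases[of G n cs]) (auto simp: placement_def extend_def Let_def)

lemma placement_grow:
  assumes "verts G = {..<n}" "0 < n" "0 < length (cop_layers G)"
  shows "placement G (grow G n q j)"
  using assms by (induction j) (simp_all add: placement_extend, simp add: placement_def)

text \<open>The first \<open>i\<close> choices depend only on the digits below position
  \<open>i\<close>, and \<open>d * b ^ j\<close> changes none of these.\<close>

lemma grow_add:
  assumes "b = 2 * length (cop_layers G)" "i \<le> j"
  shows "grow G n (q + d * b ^ j) i = grow G n q i"
  using assms(2)
proof (induction i)
  case (Suc i)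
  then obtain m where m: "j = Suc i + m" using le_Suc_ex by blast
  have "(q + d * b ^ j) div b ^ i mod b = q div b ^ i mod b"
  proof (cases "b = 0")
    case False
    have "q + d * b ^ j = q + (d * b ^ m * b) * b ^ i" by (simp add: m power_add ac_simps)
    then have "(q + d * b ^ j) div b ^ i = q div b ^ i + d * b ^ m * b"
      using False div_mult_self1[of "b ^ i" q "d * b ^ m * b"] by (simp only:) simp
    then show ?thesis by simp
  qed (simp add: m)
  then show ?case using Suc by (simp add: assms(1)[symmetric] Let_def)
qed simp

lemma weight_component:
  assumes "(x, y) \<in> (edge_rel E)\<^sup>*"
  shows "weight E y = weight E x"
proof -
  have "(y, u) \<in> (edge_rel E)\<^sup>* \<longleftrightarrow> (x, u) \<in> (edge_rel E)\<^sup>*" for u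
    using assms edge_rtrancl_sym rtrancl_trans by metis
  then show ?thesis by (intro ext) (simp add: weight_def)
qed

text \<open>The invariant of the search: the cops placed so far can be completed by part of a solution.
  An exposed pair is covered by a remaining cop of the solution, and a digit moves that cop within
  its component onto the pair.\<close>

lemma extend_towards_solution:
  assumes G: "verts G = {..<n}" and "placement G S" "safe G (cs @ S)" "S \<noteq> []"
  obtains d S' where "d < 2 * length (cop_layers G)" "length S = Suc (length S')" "placement G S'"
    "safe G (extend G n cs d @ S')"
proof -
  let ?\<tau> = "length (cop_layers G)"
  show thesis
  proof (cases rule: scan_cases[of G n cs])
    case none
    then have "safe G cs" using G by (simp add: safe_def)
    then have "safe G (extend G n cs 0 @ tl S)"
      by (simp add: extend_def Let_def case_prod_beta safe_append)
    moreover have "0 < ?\<tau>" using assms(2,4) by (cases S) (auto simp: placement_def)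
    ultimately show thesis using that[of 0 "tl S"] assms(2,4) by (cases S) (auto simp: placement_def)
  next
    case (some u v)
    have "2 \<le> score G cs u v + score G S u v"
      using assms(3) some G by (fastforce simp: safe_def exposed_def)
    then have "score G S u v \<noteq> 0" using some by (auto simp: exposed_def)
    then obtain l x where lx: "(l, x) \<in> set S" "weight (cop_layers G ! l) x u v \<noteq> 0"
      by (auto simp: score_def)
    then have "(x, u) \<in> (edge_rel (cop_layers G ! l))\<^sup>* \<or> (x, v) \<in> (edge_rel (cop_layers G ! l))\<^sup>*"
      by (auto simp: weight_def split: if_splits)
    then have "\<exists>d y. d < 2 * ?\<tau> \<and> extend G n cs d = cs @ [(l, y)] \<and>
        weight (cop_layers G ! l) y = weight (cop_layers G ! l) x"
    proof
      assume "(x, u) \<in> (edge_rel (cop_layers G ! l))\<^sup>*"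
      from weight_component[OF this] show ?thesis using lx(1) assms(2) some
        by (intro exI[of _ l] exI[of _ u]) (auto simp: extend_def placement_def)
    next
      assume "(x, v) \<in> (edge_rel (cop_layers G ! l))\<^sup>*"
      from weight_component[OF this] show ?thesis using lx(1) assms(2) some
        by (intro exI[of _ "l + ?\<tau>"] exI[of _ v]) (auto simp: extend_def placement_def)
    qed
    then obtain d y where d: "d < 2 * ?\<tau>" "extend G n cs d = cs @ [(l, y)]"
      "weight (cop_layers G ! l) y = weight (cop_layers G ! l) x" by blast
    have "score G S a b = weight (cop_layers G ! l) x a b + score G (remove1 (l, x) S) a b" for a b
      using lx(1) by (simp add: score_def sum_list_map_remove1)
    then have "score G (extend G n cs d @ remove1 (l, x) S) a b = score G (cs @ S) a b" for a b
      by (simp add: d)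
    then have "safe G (extend G n cs d @ remove1 (l, x) S)"
      using assms(3) by (simp add: safe_def exposed_def)
    moreover have "length S = Suc (length (remove1 (l, x) S))"
      using lx(1) by (simp add: length_remove1) (metis Suc_pred length_pos_if_in_set)
    moreover have "placement G (remove1 (l, x) S)"
      using assms(2) set_remove1_subset unfolding placement_def by fast
    ultimately show thesis using that d(1) by blast
  qed
qed

lemma grow_complete:
  assumes G: "verts G = {..<n}" and "length cs = k" "placement G cs" "safe G cs" "j \<le> k"
  shows "\<exists>q<(2 * length (cop_layers G)) ^ j. \<exists>S. length S = k - j \<and> placement G S \<and>
           safe G (grow G n q j @ S)"
  using assms(5)
proof (induction j)
  case 0
  show ?case using assms by auto
next
  case (Suc j)
  define b where "b = 2 * length (cop_layers G)"
  obtain q S where q: "q < b ^ j" and S: "length S = k - j" "placement G S" "safe G (grow G n q j @ S)"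
    using Suc by (auto simp: b_def)
  then have "S \<noteq> []" using Suc.prems by auto
  from extend_towards_solution[OF G S(2,3) this]
  obtain d S' where d: "d < b" "length S = Suc (length S')" "placement G S'"
    "safe G (extend G n (grow G n q j) d @ S')" unfolding b_def by blast
  \<comment> \<open>The new choice becomes the digit at position \<open>j\<close>, on top of the
    digits of \<open>q\<close>.\<close>
  let ?q = "q + d * b ^ j"
  have "?q < (1 + d) * b ^ j" using q by simp
  also have "\<dots> \<le> b * b ^ j" using d(1) by (intro mult_right_mono) auto
  finally have "?q < b ^ Suc j" by simp
  moreover have "?q div b ^ j mod b = d" using d(1) q by auto
  then have "grow G n ?q (Suc j) = extend G n (grow G n q j) d"
    using grow_add[of b G j j n q d] by (simp add: b_def[symmetric] Let_def)
  ultimately show ?case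
    using d S Suc.prems unfolding b_def[symmetric] by (intro exI[of _ ?q] conjI exI[of _ S']) auto
qed

lemma multilayer_iff_grow:
  assumes "multilayer_graph G" "is_tree (verts G) (robber_layer G)" "verts G = {..<n}"
  shows "multilayer_cops_and_robber G k \<longleftrightarrow>
    (\<exists>q<(2 * length (cop_layers G)) ^ k. safe G (grow G n q k))"
proof -
  have n: "0 < n" using assms(2,3) by (cases n) (auto simp: is_tree_def connected_graph_def)
  show ?thesis
  proof
    assume "multilayer_cops_and_robber G k"
    then show "\<exists>q<(2 * length (cop_layers G)) ^ k. safe G (grow G n q k)"
      unfolding multilayer_iff_safe[OF assms(1,2)] using grow_complete[OF assms(3), of _ k k] by fastforce
  next
    assume "\<exists>q<(2 * length (cop_layers G)) ^ k. safe G (grow G n q k)"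
    then obtain q where q: "q < (2 * length (cop_layers G)) ^ k" "safe G (grow G n q k)" by blast
    have "placement G (grow G n q k)"
    \<comment> \<open>Without cop layers the range of \<open>q\<close> is empty unless
      \<open>k = 0\<close>, where \<open>0 ^ 0 = 1\<close> admits the empty list.\<close>
    proof (cases "0 < length (cop_layers G)")
      case False
      then have "k = 0" using q(1) by (cases k) auto
      then show ?thesis by (simp add: placement_def)
    qed (use placement_grow[OF assms(3) n] in blast)
    then show "multilayer_cops_and_robber G k"
      unfolding multilayer_iff_safe[OF assms(1,2)] using q(2) by (intro exI[of _ "grow G n q k"]) simp
  qed
qed

section \<open>A loop language with time bounds read off the syntax\<close>

section \<open>Programs with bounded loops\<close>

text \<open>Counting loops make \<open>run\<close> a total function, so correctness can be argued by
  equations; the machine semantics enters only through \<open>exec_compile\<close>.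
  \<open>LFor a b P\<close> counts in cell 0 of array \<open>a\<close> up to the content of cell 0
  of array \<open>b\<close>.\<close>

datatype loop =
    LSkip
  | LWrite nat expr expr
  | LSeq loop loop
  | LIf expr loop loop
  | LFor nat nat loop

definition put :: "nat \<Rightarrow> nat \<Rightarrow> state \<Rightarrow> state" where
  "put a x s = s(a := (s a)(0 := x))"

lemma put_simps [simp]:
  "put a x s a 0 = x" "i \<noteq> 0 \<Longrightarrow> put a x s a i = s a i" "b \<noteq> a \<Longrightarrow> put a x s b = s b"
  by (auto simp: put_def)

abbreviation V :: "nat \<Rightarrow> expr" where "V a \<equiv> Read a (Const 0)"

primrec compile :: "loop \<Rightarrow> prog" where
  "compile LSkip = Skip"
| "compile (LWrite a e e') = Write a e e'"
| "compile (LSeq P Q) = Seq (compile P) (compile Q)"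
| "compile (LIf e P Q) = If e (compile P) (compile Q)"
| "compile (LFor a b P) =
     Seq (Write a (Const 0) (Const 0))
       (While (Sub (V b) (V a)) (Seq (compile P) (Write a (Const 0) (Add (V a) (Const 1)))))"

primrec run :: "loop \<Rightarrow> state \<Rightarrow> state" where
  "run LSkip = (\<lambda>s. s)"
| "run (LWrite a e e') = (\<lambda>s. s(a := (s a)(val e s := val e' s)))"
| "run (LSeq P Q) = (\<lambda>s. run Q (run P s))"
| "run (LIf e P Q) = (\<lambda>s. if val e s \<noteq> 0 then run P s else run Q s)"
| "run (LFor a b P) = (\<lambda>s. fold (\<lambda>i s. put a (Suc i) (run P s)) [0..<s b 0] (put a 0 s))"

primrec writes :: "loop \<Rightarrow> nat set" where
  "writes LSkip = {}"
| "writes (LWrite a e e') = {a}"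
| "writes (LSeq P Q) = writes P \<union> writes Q"
| "writes (LIf e P Q) = writes P \<union> writes Q"
| "writes (LFor a b P) = insert a (writes P)"

primrec bounds :: "loop \<Rightarrow> nat set" where
  "bounds LSkip = {}"
| "bounds (LWrite a e e') = {}"
| "bounds (LSeq P Q) = bounds P \<union> bounds Q"
| "bounds (LIf e P Q) = bounds P \<union> bounds Q"
| "bounds (LFor a b P) = insert b (bounds P)"

primrec wf_loop :: "loop \<Rightarrow> bool" where
  "wf_loop LSkip = True"
| "wf_loop (LWrite a e e') = True"
| "wf_loop (LSeq P Q) = (wf_loop P \<and> wf_loop Q)"
| "wf_loop (LIf e P Q) = (wf_loop P \<and> wf_loop Q)"
| "wf_loop (LFor a b P) = (a \<notin> writes P \<and> wf_loop P)"

text \<open>\<open>N\<close> gives the values of the loop bounds. The 9 consists of 3 units for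
  resetting the counter and 6 for the last test; each pass adds to its body 6 for the test and 6 for
  the increment.\<close>

primrec time_bound :: "loop \<Rightarrow> (nat \<Rightarrow> nat) \<Rightarrow> nat" where
  "time_bound LSkip N = 1"
| "time_bound (LWrite a e e') N = cost e + cost e' + 1"
| "time_bound (LSeq P Q) N = time_bound P N + time_bound Q N"
| "time_bound (LIf e P Q) N = cost e + 1 + time_bound P N + time_bound Q N"
| "time_bound (LFor a b P) N = 9 + N b * (time_bound P N + 12)"

lemma run_frame: "a \<notin> writes P \<Longrightarrow> run P s a = s a"
proof (induction P arbitrary: s)
  case (LFor c b P)
  have "fold (\<lambda>i s. put c (Suc i) (run P s)) xs s' a = s' a" for xs s'
    using LFor by (induction xs arbitrary: s') auto
  then show ?case using LFor.prems by simp
qed auto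

lemma time_bound_cong: "(\<And>b. b \<in> bounds P \<Longrightarrow> N b = N' b) \<Longrightarrow> time_bound P N = time_bound P N'"
  by (induction P) auto

text \<open>No loop bound is written, so all loops, nested ones included, run as often as the
  initial state says; hence the time bound may be evaluated there.\<close>

lemma exec_compile:
  assumes "wf_loop P" "bounds P \<inter> writes P = {}"
  shows "\<exists>t. exec (compile P) s t (run P s) \<and> t \<le> time_bound P (\<lambda>b. s b 0)"
  using assms
proof (induction P arbitrary: s)
  case LSkip
  then show ?case using exec.Skip by auto
next
  case (LWrite a e e')
  then show ?case using exec.Write[of a e e' s] by (intro exI[of _ "cost e + cost e' + 1"]) (simp del: fun_upd_apply)
next
  case (LSeq P Q)
  obtain t where t: "exec (compile P) s t (run P s)" "t \<le> time_bound P (\<lambda>b. s b 0)"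
    using LSeq by fastforce
  obtain t' where t': "exec (compile Q) (run P s) t' (run Q (run P s))"
    "t' \<le> time_bound Q (\<lambda>b. run P s b 0)"
    using LSeq by fastforce
  have "time_bound Q (\<lambda>b. run P s b 0) = time_bound Q (\<lambda>b. s b 0)"
  proof (rule time_bound_cong)
    fix b assume "b \<in> bounds Q"
    then have "b \<notin> writes P" using LSeq.prems by auto
    then show "run P s b 0 = s b 0" by (simp add: run_frame)
  qed
  then show ?case using exec.Seq[OF t(1) t'(1)] t t' by (intro exI[of _ "t + t'"]) auto
next
  case (LIf e P Q)
  show ?case
  proof (cases "val e s = 0")
    case True
    obtain t where t: "exec (compile Q) s t (run Q s)" "t \<le> time_bound Q (\<lambda>b. s b 0)"
      using LIf by fastforce
    show ?thesis using exec.IfFalse[OF True t(1)] t True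
      by (intro exI[of _ "cost e + 1 + t"]) auto
  next
    case False
    obtain t where t: "exec (compile P) s t (run P s)" "t \<le> time_bound P (\<lambda>b. s b 0)"
      using LIf by fastforce
    show ?thesis using exec.IfTrue[OF False t(1)] t False
      by (intro exI[of _ "cost e + 1 + t"]) auto
  qed
next
  case (LFor a b P)
  define N where "N = s b 0"
  define T where "T = time_bound P (\<lambda>b. s b 0)"
  let ?W = "While (Sub (V b) (V a)) (Seq (compile P) (Write a (Const 0) (Add (V a) (Const 1))))"
  let ?g = "\<lambda>i s. put a (Suc i) (run P s)"
  have ab: "a \<noteq> b" "b \<notin> writes P" "a \<notin> writes P" "a \<notin> bounds P" and P: "wf_loop P" "bounds P \<inter> writes P = {}"
    using LFor.prems by auto
  have loop: "\<exists>t. exec ?W s' t (fold ?g [i..<N] s') \<and> t \<le> 6 + (N - i) * (T + 12)"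
    if "i \<le> N" "s' a 0 = i" "s' b 0 = N" "\<And>c. c \<in> bounds P \<Longrightarrow> s' c 0 = s c 0" for i s'
    using that
  proof (induction "N - i" arbitrary: i s')
    case 0
    then have "exec ?W s' (cost (Sub (V b) (V a)) + 1) s'" by (intro exec.WhileFalse) auto
    moreover have "cost (Sub (V b) (V a)) + 1 = 6" by simp
    ultimately have "exec ?W s' 6 s'" by metis
    then show ?case using 0 by (intro exI[of _ 6]) auto
  next
    case (Suc m)
    obtain t where t: "exec (compile P) s' t (run P s')" "t \<le> time_bound P (\<lambda>b. s' b 0)"
      using LFor.IH[OF P] by blast
    have tT: "t \<le> T"
      using t(2) time_bound_cong[of P "\<lambda>b. s' b 0" "\<lambda>b. s b 0"] Suc.prems(4) by (simp add: T_def)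
    have "cost (Const 0) + cost (Add (V a) (Const 1)) + 1 = 6" by simp
    then have "exec (Write a (Const 0) (Add (V a) (Const 1))) (run P s') 6 (?g i s')"
      using exec.Write[of a "Const 0" "Add (V a) (Const 1)" "run P s'"] Suc.prems ab
      by (simp only:) (simp add: put_def run_frame)
    from exec.Seq[OF t(1) this]
    have body: "exec (Seq (compile P) (Write a (Const 0) (Add (V a) (Const 1)))) s' (t + 6) (?g i s')" .
    have "\<exists>t. exec ?W (?g i s') t (fold ?g [Suc i..<N] (?g i s')) \<and> t \<le> 6 + (N - Suc i) * (T + 12)"
    proof (rule Suc.hyps(1))
      show "m = N - Suc i" "Suc i \<le> N" using Suc.hyps(2) by auto
      show "?g i s' a 0 = Suc i" "?g i s' b 0 = N" using ab Suc.prems by (auto simp: run_frame)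
      fix c assume c: "c \<in> bounds P"
      then have "c \<noteq> a" "c \<notin> writes P" using ab P by auto
      then show "?g i s' c 0 = s c 0" using Suc.prems(4)[OF c] by (simp add: run_frame)
    qed
    then obtain t' where t': "exec ?W (?g i s') t' (fold ?g [Suc i..<N] (?g i s'))"
      "t' \<le> 6 + (N - Suc i) * (T + 12)" by blast
    have "val (Sub (V b) (V a)) s' \<noteq> 0" using Suc by simp
    from exec.WhileTrue[OF this body t'(1)]
    have *: "exec ?W s' (5 + 1 + (t + 6) + t') (fold ?g [i..<N] s')"
      using Suc.hyps(2) by (simp add: upt_conv_Cons)
    have "(N - i) * (T + 12) = T + 12 + (N - Suc i) * (T + 12)"
      using Suc.hyps(2) by (metis Suc_diff_Suc mult_Suc zero_less_Suc zero_less_diff)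
    then show ?case using * t' tT by (intro exI[of _ "5 + 1 + (t + 6) + t'"]) auto
  qed
  have "\<exists>t. exec ?W (put a 0 s) t (fold ?g [0..<N] (put a 0 s)) \<and> t \<le> 6 + (N - 0) * (T + 12)"
  proof (rule loop)
    show "put a 0 s c 0 = s c 0" if "c \<in> bounds P" for c using that ab(4) by (cases "c = a") auto
  qed (use ab N_def in auto)
  then obtain t where t: "exec ?W (put a 0 s) t (fold ?g [0..<N] (put a 0 s))" "t \<le> 6 + N * (T + 12)"
    by auto
  have "exec (Write a (Const 0) (Const 0)) s 3 (put a 0 s)"
    using exec.Write[of a "Const 0" "Const 0" s] by (simp add: put_def eval_nat_numeral)
  from exec.Seq[OF this t(1)] show ?case using t(2)
    by (intro exI[of _ "3 + t"]) (auto simp: N_def T_def)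
qed

text \<open>A loop multiplies the bound by at most a constant times \<open>Z\<close>, and sequencing
  adds. So the time is polynomial in the largest loop bound, with coefficient and degree fixed by
  the program alone.\<close>

lemma time_bound_power:
  "\<exists>c d. \<forall>N Z. (\<forall>b\<in>bounds P. N b \<le> Z) \<longrightarrow> 1 \<le> Z \<longrightarrow> time_bound P N \<le> c * Z ^ d"
proof (induction P)
  case LSkip
  show ?case by (intro exI[of _ 1] exI[of _ 0]) auto
next
  case (LWrite a e e')
  show ?case by (intro exI[of _ "cost e + cost e' + 1"] exI[of _ 0]) auto
next
  case (LSeq P Q)
  then obtain c d c' d' where
    1: "\<And>N Z. (\<forall>b\<in>bounds P. N b \<le> Z) \<Longrightarrow> 1 \<le> Z \<Longrightarrow> time_bound P N \<le> c * Z ^ d" and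
    2: "\<And>N Z. (\<forall>b\<in>bounds Q. N b \<le> Z) \<Longrightarrow> 1 \<le> Z \<Longrightarrow> time_bound Q N \<le> c' * Z ^ d'" by metis
  have "time_bound P N + time_bound Q N \<le> (c + c') * Z ^ (d + d')"
    if "\<forall>b\<in>bounds P \<union> bounds Q. N b \<le> Z" "1 \<le> Z" for N Z
  proof -
    have "c * Z ^ d \<le> c * Z ^ (d + d')" "c' * Z ^ d' \<le> c' * Z ^ (d + d')"
      using that(2) by (auto intro!: mult_left_mono power_increasing)
    moreover have "time_bound P N \<le> c * Z ^ d" "time_bound Q N \<le> c' * Z ^ d'"
      using 1[of N Z] 2[of N Z] that by auto
    ultimately show ?thesis unfolding add_mult_distrib by linarith
  qed
  then show ?case by (intro exI[of _ "c + c'"] exI[of _ "d + d'"]) auto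
next
  case (LIf e P Q)
  then obtain c d c' d' where
    1: "\<And>N Z. (\<forall>b\<in>bounds P. N b \<le> Z) \<Longrightarrow> 1 \<le> Z \<Longrightarrow> time_bound P N \<le> c * Z ^ d" and
    2: "\<And>N Z. (\<forall>b\<in>bounds Q. N b \<le> Z) \<Longrightarrow> 1 \<le> Z \<Longrightarrow> time_bound Q N \<le> c' * Z ^ d'" by metis
  have "cost e + 1 + time_bound P N + time_bound Q N \<le> (cost e + 1 + c + c') * Z ^ (d + d')"
    if "\<forall>b\<in>bounds P \<union> bounds Q. N b \<le> Z" "1 \<le> Z" for N Z
  proof -
    have "c * Z ^ d \<le> c * Z ^ (d + d')" "c' * Z ^ d' \<le> c' * Z ^ (d + d')"
      "(cost e + 1) * 1 \<le> (cost e + 1) * Z ^ (d + d')"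
      using that(2) by (auto intro!: mult_left_mono power_increasing simp del: mult_Suc)
    moreover have "time_bound P N \<le> c * Z ^ d" "time_bound Q N \<le> c' * Z ^ d'"
      using 1[of N Z] 2[of N Z] that by auto
    ultimately show ?thesis unfolding add_mult_distrib by linarith
  qed
  then show ?case by (intro exI[of _ "cost e + 1 + c + c'"] exI[of _ "d + d'"]) auto
next
  case (LFor a b P)
  then obtain c d where
    1: "\<And>N Z. (\<forall>b\<in>bounds P. N b \<le> Z) \<Longrightarrow> 1 \<le> Z \<Longrightarrow> time_bound P N \<le> c * Z ^ d" by metis
  have "9 + N b * (time_bound P N + 12) \<le> (c + 21) * Z ^ (d + 1)"
    if "\<forall>b\<in>insert b (bounds P). N b \<le> Z" "1 \<le> Z" for N Z
  proof -
    have "1 \<le> Z ^ d" "1 \<le> Z ^ (d + 1)" using that(2) by auto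
    then have "time_bound P N + 12 \<le> (c + 12) * Z ^ d"
      using add_mono[OF 1[of N Z], of 12 "12 * Z ^ d"] that unfolding add_mult_distrib by simp
    then have "N b * (time_bound P N + 12) \<le> Z * ((c + 12) * Z ^ d)"
      using that by (intro mult_mono) auto
    moreover have "9 \<le> 9 * Z ^ (d + 1)" using \<open>1 \<le> Z ^ (d + 1)\<close> by simp
    ultimately have "9 + N b * (time_bound P N + 12) \<le> 9 * Z ^ (d + 1) + Z * ((c + 12) * Z ^ d)"
      by linarith
    also have "\<dots> = (c + 21) * Z ^ (d + 1)" by (simp add: algebra_simps)
    finally show ?thesis .
  qed
  then show ?case by (intro exI[of _ "c + 21"] exI[of _ "d + 1"]) auto
qed

text \<open>A Hoare rule with the frame condition built in: arrays that the loop does not write keep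
  their initial contents, so invariants mention only what changes.\<close>

lemma run_LFor_rule:
  assumes "a \<notin> writes P" "s b 0 = N" "I 0 (put a 0 s)"
    and "\<And>i s'. i < N \<Longrightarrow> s' a 0 = i \<Longrightarrow> (\<And>x. x \<notin> writes P \<Longrightarrow> x \<noteq> a \<Longrightarrow> s' x = s x) \<Longrightarrow> I i s' \<Longrightarrow>
           I (Suc i) (put a (Suc i) (run P s'))"
  shows "I N (run (LFor a b P) s)"
proof -
  let ?g = "\<lambda>i s. put a (Suc i) (run P s)"
  let ?s = "\<lambda>i. fold ?g [0..<i] (put a 0 s)"
  have "I i (?s i) \<and> ?s i a 0 = i \<and> (\<forall>x. x \<notin> writes P \<longrightarrow> x \<noteq> a \<longrightarrow> ?s i x = s x)" if "i \<le> N" for i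
    using that
  proof (induction i)
    case (Suc i)
    then show ?case using assms(4)[of i "?s i"] by (auto simp: run_frame)
  qed (use assms in auto)
  then show ?thesis using assms(2) by auto
qed

section \<open>Tables computed with addition and truncated subtraction\<close>

section \<open>Tables\<close>

text \<open>Truncated \<open>1 - e\<close> is negation, and two numbers are equal iff both truncated
  differences vanish.\<close>

definition notE :: "expr \<Rightarrow> expr" where "notE e = Sub (Const 1) e"
definition orE :: "expr \<Rightarrow> expr \<Rightarrow> expr" where "orE e e' = notE (notE (Add e e'))"
definition andE :: "expr \<Rightarrow> expr \<Rightarrow> expr" where "andE e e' = notE (Add (notE e) (notE e'))"
definition eqE :: "expr \<Rightarrow> expr \<Rightarrow> expr" where "eqE e e' = notE (Add (Sub e e') (Sub e' e))"

lemma val_boolE [simp]: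
  "val (notE e) s = of_bool (val e s = 0)"
  "val (orE e e') s = of_bool (val e s \<noteq> 0 \<or> val e' s \<noteq> 0)"
  "val (andE e e') s = of_bool (val e s \<noteq> 0 \<and> val e' s \<noteq> 0)"
  "val (eqE e e') s = of_bool (val e s = val e' s)"
  by (auto simp: notE_def orE_def andE_def eqE_def)

definition ix :: "nat \<Rightarrow> nat \<Rightarrow> nat \<Rightarrow> nat \<Rightarrow> nat" where
  "ix n l u v = l * (n * n) + (u * n + v)"

text \<open>\<open>v\<close> and \<open>u\<close> are the two lowest base-\<open>n\<close> digits
  and \<open>l\<close> is the rest, so distinct table entries never share a cell.\<close>

lemma ix_inject:
  assumes "u < n" "v < n" "u' < n" "v' < n"
  shows "ix n l u v = ix n l' u' v' \<longleftrightarrow> l = l' \<and> u = u' \<and> v = v'"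
proof
  assume eq: "ix n l u v = ix n l' u' v'"
  have ix: "ix n l u v = (l * n + u) * n + v" for l u v by (simp add: ix_def algebra_simps)
  have "(l * n + u) * n + v = (l' * n + u') * n + v'" using eq by (simp add: ix)
  then have 1: "l * n + u = l' * n + u' \<and> v = v'" using assms
    by (metis add_right_cancel div_mult_self3 div_less mod_less mod_mult_self3 add_0_right less_nat_zero_code)
  then have "l = l' \<and> u = u'" using assms
    by (metis div_mult_self3 div_less mod_less mod_mult_self3 add_0_right less_nat_zero_code)
  with 1 show "l = l' \<and> u = u' \<and> v = v'" by simp
qed simp

text \<open>Arrays 1 to 5 hold \<open>n\<close>, \<open>\<tau>\<close>, \<open>k\<close>, \<open>2 \<tau>\<close> and \<open>(2 \<tau>) ^ k\<close>; arrays 6 and 7 hold the multiples of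
  \<open>n\<close> and of \<open>n * n\<close>, from which positions in three-dimensional tables are computed without
  multiplication. Arrays 8, 9 and 10 are such tables, for distance at most 1, connectedness and
  distance at most 2 in the cop layers; arrays 11 and 12 tabulate quotient and remainder of division
  by \<open>2 \<tau>\<close>. The counters of the loops over rounds, layers and two vertices are 14 to 17. Arrays 28
  and 29 list the layers and vertices of the cops (25 of them), 23 and 24 hold an exposed pair if
  the flag 22 is set, and 30 is the answer.\<close>

definition ixE :: "expr \<Rightarrow> expr \<Rightarrow> expr \<Rightarrow> expr" where
  "ixE l u v = Add (Read 7 l) (Add (Read 6 u) v)"

definition offsets :: "nat \<Rightarrow> nat \<Rightarrow> state \<Rightarrow> bool" where
  "offsets n \<tau> s \<longleftrightarrow> s 1 0 = n \<and> s 2 0 = \<tau> \<and> (\<forall>u\<le>n. s 6 u = u * n) \<and> (\<forall>l\<le>\<tau>. s 7 l = l * (n * n))"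

lemma val_ixE [simp]:
  "offsets n \<tau> s \<Longrightarrow> val l s \<le> \<tau> \<Longrightarrow> val u s \<le> n \<Longrightarrow>
   val (ixE l u v) s = ix n (val l s) (val u s) (val v s)"
  by (simp add: ixE_def ix_def offsets_def)

lemma offsets_cong:
  assumes "s' 1 = s 1" "s' 2 = s 2" "s' 6 = s 6" "s' 7 = s 7"
  shows "offsets n \<tau> s' = offsets n \<tau> s"
  using assms by (simp add: offsets_def)

text \<open>Array 6 is filled up to index \<open>n\<close>, one beyond the last vertex, because that
  entry is \<open>n * n\<close>, the increment for array 7.\<close>

definition offset_prog :: loop where
  "offset_prog =
     LSeq (LFor 16 1 (LWrite 6 (Add (V 16) (Const 1)) (Add (Read 6 (V 16)) (V 1))))
       (LFor 15 2 (LWrite 7 (Add (V 15) (Const 1)) (Add (Read 7 (V 15)) (Read 6 (V 1)))))"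

lemma run_offset_prog:
  assumes "s 1 0 = n" "s 2 0 = \<tau>" "s 6 0 = 0" "s 7 0 = 0"
  shows "offsets n \<tau> (run offset_prog s)"
proof -
  let ?P = "LFor 16 1 (LWrite 6 (Add (V 16) (Const 1)) (Add (Read 6 (V 16)) (V 1)))"
  let ?Q = "LFor 15 2 (LWrite 7 (Add (V 15) (Const 1)) (Add (Read 7 (V 15)) (Read 6 (V 1))))"
  have P: "\<forall>u\<le>n. run ?P s 6 u = u * n"
    by (rule run_LFor_rule[where N = n and I = "\<lambda>i s'. \<forall>u\<le>i. s' 6 u = u * n"])
       (use assms in \<open>auto simp: le_Suc_eq\<close>)
  define s1 where "s1 = run ?P s"
  have P1: "\<forall>u\<le>n. s1 6 u = u * n" using P by (simp only: s1_def)
  have s1: "s1 1 = s 1" "s1 2 = s 2" "s1 7 = s 7" by (simp_all add: s1_def run_frame del: run.simps)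
  have "\<forall>l\<le>\<tau>. run ?Q s1 7 l = l * (n * n)"
    by (rule run_LFor_rule[where N = \<tau> and I = "\<lambda>i s'. \<forall>l\<le>i. s' 7 l = l * (n * n)"])
       (use assms s1 P1 in \<open>auto simp: le_Suc_eq\<close>)
  moreover have "run ?Q s1 1 = s 1" "run ?Q s1 2 = s 2" "run ?Q s1 6 = s1 6"
    using s1 by (simp_all add: run_frame del: run.simps)
  ultimately show ?thesis
    using P1 assms unfolding offset_prog_def run.simps(3) s1_def[symmetric] by (simp add: offsets_def)
qed

definition LFor3 :: "loop \<Rightarrow> loop" where
  "LFor3 P = LFor 15 2 (LFor 16 1 (LFor 17 1 P))"

lemma writes_LFor3 [simp]: "writes (LFor3 P) = {15, 16, 17} \<union> writes P"
  by (auto simp: LFor3_def)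

text \<open>The invariant refers to the set of triples visited so far and must be preserved for an
  arbitrary set, which frees its applications from the order of the three loops.\<close>

lemma run_LFor3_rule:
  assumes P: "writes P \<inter> {1, 2, 15, 16, 17} = {}" and T: "T \<notin> {15, 16, 17}"
    and s: "s 1 0 = n" "s 2 0 = \<tau>" and I: "I {} (s T)"
    and step: "\<And>X l u v s'. l < \<tau> \<Longrightarrow> u < n \<Longrightarrow> v < n \<Longrightarrow>
      s' 15 0 = l \<Longrightarrow> s' 16 0 = u \<Longrightarrow> s' 17 0 = v \<Longrightarrow>
      (\<And>x. x \<notin> writes P \<Longrightarrow> x \<notin> {15, 16, 17} \<Longrightarrow> s' x = s x) \<Longrightarrow> I X (s' T) \<Longrightarrow>
      I (insert (l, u, v) X) (run P s' T)"
  shows "I ({..<\<tau>} \<times> {..<n} \<times> {..<n}) (run (LFor3 P) s T)"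
  unfolding LFor3_def
proof (rule run_LFor_rule[where N = \<tau> and I = "\<lambda>i s'. I ({..<i} \<times> {..<n} \<times> {..<n}) (s' T)"])
  fix l s1
  assume 1: "l < \<tau>" "s1 15 0 = l" "I ({..<l} \<times> {..<n} \<times> {..<n}) (s1 T)"
    "\<And>x. x \<notin> writes (LFor 16 1 (LFor 17 1 P)) \<Longrightarrow> x \<noteq> 15 \<Longrightarrow> s1 x = s x"
  have "I ({..<l} \<times> {..<n} \<times> {..<n} \<union> {l} \<times> {..<n} \<times> {..<n}) (run (LFor 16 1 (LFor 17 1 P)) s1 T)"
  proof (rule run_LFor_rule[where N = n and
        I = "\<lambda>i s'. I ({..<l} \<times> {..<n} \<times> {..<n} \<union> {l} \<times> {..<i} \<times> {..<n}) (s' T)"])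
    fix u s2
    assume 2: "u < n" "s2 16 0 = u"
      "I ({..<l} \<times> {..<n} \<times> {..<n} \<union> {l} \<times> {..<u} \<times> {..<n}) (s2 T)"
      "\<And>x. x \<notin> writes (LFor 17 1 P) \<Longrightarrow> x \<noteq> 16 \<Longrightarrow> s2 x = s1 x"
    let ?X = "{..<l} \<times> {..<n} \<times> {..<n} \<union> {l} \<times> {..<u} \<times> {..<n}"
    have "I (?X \<union> {l} \<times> {u} \<times> {..<n}) (run (LFor 17 1 P) s2 T)"
    proof (rule run_LFor_rule[where N = n and I = "\<lambda>i s'. I (?X \<union> {l} \<times> {u} \<times> {..<i}) (s' T)"])
      fix v s3
      assume 3: "v < n" "s3 17 0 = v" "I (?X \<union> {l} \<times> {u} \<times> {..<v}) (s3 T)"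
        "\<And>x. x \<notin> writes P \<Longrightarrow> x \<noteq> 17 \<Longrightarrow> s3 x = s2 x"
      have "I (insert (l, u, v) (?X \<union> {l} \<times> {u} \<times> {..<v})) (run P s3 T)"
      proof (rule step)
        have "s3 15 = s1 15" "s3 16 = s2 16" using 2(4) 3(4) P by auto
        then show "s3 15 0 = l" "s3 16 0 = u" using 1(2) 2(2) by auto
        show "s3 x = s x" if "x \<notin> writes P" "x \<notin> {15, 16, 17}" for x
          using that 1(4)[of x] 2(4)[of x] 3(4)[of x] by simp
      qed (use 1 2 3 in auto)
      moreover have "insert (l, u, v) (?X \<union> {l} \<times> {u} \<times> {..<v}) = ?X \<union> {l} \<times> {u} \<times> {..<Suc v}" by auto
      ultimately show "I (?X \<union> {l} \<times> {u} \<times> {..<Suc v}) (put 17 (Suc v) (run P s3) T)" using T by simp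
    qed (use P T s 1 2 in auto)
    moreover have "?X \<union> {l} \<times> {u} \<times> {..<n} = {..<l} \<times> {..<n} \<times> {..<n} \<union> {l} \<times> {..<Suc u} \<times> {..<n}" by auto
    ultimately show "I ({..<l} \<times> {..<n} \<times> {..<n} \<union> {l} \<times> {..<Suc u} \<times> {..<n})
        (put 16 (Suc u) (run (LFor 17 1 P) s2) T)" using T by simp
  qed (use P T s 1 in auto)
  moreover have "{..<l} \<times> {..<n} \<times> {..<n} \<union> {l} \<times> {..<n} \<times> {..<n} = {..<Suc l} \<times> {..<n} \<times> {..<n}" by auto
  ultimately show "I ({..<Suc l} \<times> {..<n} \<times> {..<n}) (put 15 (Suc l) (run (LFor 16 1 (LFor 17 1 P)) s1) T)"
    using T by simp
qed (use P T s I in auto)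

lemma run_fill:
  assumes s: "offsets n \<tau> s" and T: "T \<notin> {1, 2, 6, 7, 15, 16, 17}"
    and e: "\<And>l u v s'. l < \<tau> \<Longrightarrow> u < n \<Longrightarrow> v < n \<Longrightarrow> s' 15 0 = l \<Longrightarrow> s' 16 0 = u \<Longrightarrow> s' 17 0 = v \<Longrightarrow>
      (\<And>x. x \<notin> {T, 15, 16, 17} \<Longrightarrow> s' x = s x) \<Longrightarrow> val e s' = F l u v"
    and "l < \<tau>" "u < n" "v < n"
  shows "run (LFor3 (LWrite T (ixE (V 15) (V 16) (V 17)) e)) s T (ix n l u v) = F l u v"
proof -
  let ?P = "LWrite T (ixE (V 15) (V 16) (V 17)) e"
  let ?I = "\<lambda>X t. \<forall>l u v. l < \<tau> \<longrightarrow> u < n \<longrightarrow> v < n \<longrightarrow> (l, u, v) \<in> X \<longrightarrow> t (ix n l u v) = F l u v"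
  have "?I ({..<\<tau>} \<times> {..<n} \<times> {..<n}) (run (LFor3 ?P) s T)"
  proof (rule run_LFor3_rule)
    fix X l u v s'
    assume a: "l < \<tau>" "u < n" "v < n" "s' 15 0 = l" "s' 16 0 = u" "s' 17 0 = v"
      "\<And>x. x \<notin> writes ?P \<Longrightarrow> x \<notin> {15, 16, 17} \<Longrightarrow> s' x = s x" "?I X (s' T)"
    have "offsets n \<tau> s'" using offsets_cong[of s' s] s a(7) T by simp
    then have "val (ixE (V 15) (V 16) (V 17)) s' = ix n l u v" using a by simp
    moreover have "val e s' = F l u v" using e a by simp
    ultimately show "?I (insert (l, u, v) X) (run ?P s' T)" using a by (auto simp: ix_inject)
  qed (use s T in \<open>auto simp: offsets_def\<close>)
  then show ?thesis using assms by simp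
qed

definition joinE :: "nat \<Rightarrow> expr" where
  "joinE S = andE (Read S (ixE (V 15) (V 16) (V 14))) (Read S (ixE (V 15) (V 14) (V 17)))"

text \<open>The contribution of one middle vertex, held in array 14, to a Boolean matrix product.
  With \<open>S = T\<close> this is one round of transitive closure; otherwise the square of
  \<open>S\<close> accumulates in \<open>T\<close>.\<close>

definition join_prog :: "nat \<Rightarrow> nat \<Rightarrow> loop" where
  "join_prog S T = LFor3 (LIf (joinE S) (LWrite T (ixE (V 15) (V 16) (V 17)) (Const 1)) LSkip)"

lemma run_join_prog:
  assumes s: "offsets n \<tau> s" "s 14 0 = w" "w < n"
    and T: "T \<notin> {1, 2, 6, 7, 14, 15, 16, 17}" "S \<notin> {1, 2, 6, 7, 14, 15, 16, 17}"
    and "l < \<tau>" "u < n" "v < n"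
  shows "run (join_prog S T) s T (ix n l u v) \<noteq> 0 \<longleftrightarrow>
    s T (ix n l u v) \<noteq> 0 \<or> s S (ix n l u w) \<noteq> 0 \<and> s S (ix n l w v) \<noteq> 0"
proof -
  let ?P = "LIf (joinE S) (LWrite T (ixE (V 15) (V 16) (V 17)) (Const 1)) LSkip"
  let ?I = "\<lambda>X t. \<forall>l u v. l < \<tau> \<longrightarrow> u < n \<longrightarrow> v < n \<longrightarrow> (t (ix n l u v) \<noteq> 0 \<longleftrightarrow>
    s T (ix n l u v) \<noteq> 0 \<or> (l, u, v) \<in> X \<and> s S (ix n l u w) \<noteq> 0 \<and> s S (ix n l w v) \<noteq> 0)"
  have "?I ({..<\<tau>} \<times> {..<n} \<times> {..<n}) (run (LFor3 ?P) s T)"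
  proof (rule run_LFor3_rule)
    fix X l u v s'
    assume a: "l < \<tau>" "u < n" "v < n" "s' 15 0 = l" "s' 16 0 = u" "s' 17 0 = v"
      "\<And>x. x \<notin> writes ?P \<Longrightarrow> x \<notin> {15, 16, 17} \<Longrightarrow> s' x = s x" and I: "?I X (s' T)"
    have off: "offsets n \<tau> s'" using offsets_cong[of s' s] s(1) a(7)[of 1] a(7)[of 2] a(7)[of 6] a(7)[of 7] T by auto
    then have ix: "val (ixE (V 15) (V 16) (V 17)) s' = ix n l u v" using a by simp
    have w: "s' 14 0 = w" using a(7)[of 14] T s by simp
    \<comment> \<open>For \<open>S = T\<close> the pass works in place, but no entry in row or
      column \<open>w\<close> changes its truth value: the update of \<open>(u, w)\<close> requires
      \<open>(u, w)\<close> to be nonzero already, and likewise for \<open>(w, v)\<close>.\<close>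
    have "s' S (ix n l u w) \<noteq> 0 \<longleftrightarrow> s S (ix n l u w) \<noteq> 0" "s' S (ix n l w v) \<noteq> 0 \<longleftrightarrow> s S (ix n l w v) \<noteq> 0"
      using a(1-3) a(7)[of S] I s(3) T by (cases "S = T"; simp; blast)+
    then have "val (joinE S) s' = of_bool (s S (ix n l u w) \<noteq> 0 \<and> s S (ix n l w v) \<noteq> 0)"
      using off a w s(3) by (simp add: joinE_def)
    then show "?I (insert (l, u, v) X) (run ?P s' T)" using a(1-3) ix I
      by (auto simp: ix_inject)
  qed (use s T in \<open>auto simp: offsets_def\<close>)
  then show ?thesis using assms by (simp add: join_prog_def)
qed

definition closure_prog :: loop where "closure_prog = LFor 14 1 (join_prog 9 9)"

lemma writes_join_prog [simp]: "writes (join_prog S T) = {15, 16, 17, T}"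
  by (auto simp: join_prog_def)

text \<open>Warshall's algorithm.\<close>

lemma run_closure_prog:
  assumes s: "offsets n \<tau> s"
    and refl: "\<And>l u. l < \<tau> \<Longrightarrow> u < n \<Longrightarrow> s 9 (ix n l u u) \<noteq> 0"
    and "l < \<tau>" "u < n" "v < n"
  shows "run closure_prog s 9 (ix n l u v) \<noteq> 0 \<longleftrightarrow>
    (u, v) \<in> {(a, b). a < n \<and> b < n \<and> s 9 (ix n l a b) \<noteq> 0}\<^sup>*"
proof -
  let ?r = "\<lambda>s l u v. s 9 (ix n l u v) \<noteq> (0 :: nat)"
  let ?E = "\<lambda>l. {(a, b). a < n \<and> b < n \<and> ?r s l a b}\<^sup>*"
  \<comment> \<open>Instead of walks with restricted interior, the invariant says that the relation
    lies between the given one and its closure and is closed under composition at middle vertices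
    below \<open>w\<close>. At \<open>w = n\<close> this is transitivity.\<close>
  let ?I = "\<lambda>w s'. \<forall>l<\<tau>. \<forall>u<n. \<forall>v<n. (?r s l u v \<longrightarrow> ?r s' l u v) \<and> (?r s' l u v \<longrightarrow> (u, v) \<in> ?E l) \<and>
    (\<forall>z<w. ?r s' l u z \<longrightarrow> ?r s' l z v \<longrightarrow> ?r s' l u v)"
  have I: "?I n (run closure_prog s)"
    unfolding closure_prog_def
  proof (rule run_LFor_rule[where N = n and I = ?I])
    fix w s'
    assume a: "w < n" "s' 14 0 = w" "\<And>x. x \<notin> writes (join_prog 9 9) \<Longrightarrow> x \<noteq> 14 \<Longrightarrow> s' x = s x" and I: "?I w s'"
    let ?t = "run (join_prog 9 9) s'"
    have off: "offsets n \<tau> s'" using offsets_cong[of s' s] s a(3) by simp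
    have t: "?r ?t l u v \<longleftrightarrow> ?r s' l u v \<or> ?r s' l u w \<and> ?r s' l w v" if "l < \<tau>" "u < n" "v < n" for l u v
      using run_join_prog[OF off a(2,1), of 9 9] that by simp
    have "?I (Suc w) ?t"
    proof (intro allI impI conjI)
      fix l u v assume b: "l < \<tau>" "u < n" "v < n"
      show "?r ?t l u v" if "?r s l u v" using I t b that by blast
      show "(u, v) \<in> ?E l" if "?r ?t l u v" using I t b that a(1) by (meson rtrancl_trans)
      fix z assume z: "z < Suc w" "?r ?t l u z" "?r ?t l z v"
      then have zn: "z < n" using a(1) by simp
      have J: "?r s' l x y" if "y' < w" "?r s' l x y'" "?r s' l y' y" "x < n" "y < n" for x y y'
        using I b that by blast
      show "?r ?t l u v"
      proof (cases "z = w")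
        case True
        then show ?thesis using z(2,3) t b a(1) by blast
      next
        case False
        then have "z < w" using z(1) by simp
        then show ?thesis using z(2,3) unfolding t[OF b] t[OF b(1,2) zn] t[OF b(1) zn b(3)]
          using J b zn a(1) by meson
      qed
    qed
    then show "?I (Suc w) (put 14 (Suc w) ?t)" by simp
  qed (use s in \<open>auto simp: offsets_def\<close>)
  let ?t = "run closure_prog s"
  show ?thesis
  proof
    assume "(u, v) \<in> ?E l"
    then show "?r ?t l u v"
    proof (induction rule: rtrancl_induct)
      case base
      then show ?case using I refl assms by blast
    next
      case (step y z)
      then have "y < n" "z < n" "?r s l y z" by auto
      then show ?case using I step.IH assms by blast
    qed
  qed (use I assms in blast)
qed

definition near_prog :: loop where "near_prog = LFor 14 1 (join_prog 8 10)"

lemma run_near_prog: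
  assumes s: "offsets n \<tau> s" "\<And>i. s 10 i = 0" and "l < \<tau>" "u < n" "v < n"
  shows "run near_prog s 10 (ix n l u v) \<noteq> 0 \<longleftrightarrow> (\<exists>z<n. s 8 (ix n l u z) \<noteq> 0 \<and> s 8 (ix n l z v) \<noteq> 0)"
proof -
  let ?I = "\<lambda>w s'. \<forall>l<\<tau>. \<forall>u<n. \<forall>v<n. s' 10 (ix n l u v) \<noteq> (0::nat) \<longleftrightarrow>
    (\<exists>z<w. s 8 (ix n l u z) \<noteq> 0 \<and> s 8 (ix n l z v) \<noteq> 0)"
  have "?I n (run near_prog s)"
    unfolding near_prog_def
  proof (rule run_LFor_rule[where N = n and I = ?I])
    fix w s'
    assume a: "w < n" "s' 14 0 = w" "\<And>x. x \<notin> writes (join_prog 8 10) \<Longrightarrow> x \<noteq> 14 \<Longrightarrow> s' x = s x" and I: "?I w s'"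
    let ?t = "run (join_prog 8 10) s'"
    have off: "offsets n \<tau> s'" using offsets_cong[of s' s] s(1) a(3) by simp
    have 8: "s' 8 = s 8" using a(3) by simp
    have "?t 10 (ix n l u v) \<noteq> 0 \<longleftrightarrow> s' 10 (ix n l u v) \<noteq> 0 \<or> s 8 (ix n l u w) \<noteq> 0 \<and> s 8 (ix n l w v) \<noteq> 0"
      if "l < \<tau>" "u < n" "v < n" for l u v
      using run_join_prog[OF off a(2,1), of 10 8] that 8 by simp
    then have "?I (Suc w) ?t" using I by (simp add: less_Suc_eq) blast
    then show "?I (Suc w) (put 14 (Suc w) ?t)" by simp
  qed (use s in \<open>auto simp: offsets_def\<close>)
  then show ?thesis using assms by blast
qed

text \<open>The current power is summed as often as array 4 says, and not array 4 as often as the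
  power says: array 5 is written here and could not serve as a loop bound.\<close>

definition pow_prog :: loop where
  "pow_prog = LSeq (LWrite 5 (Const 0) (Const 1))
     (LFor 18 3 (LSeq (LWrite 32 (Const 0) (Const 0))
       (LSeq (LFor 19 4 (LWrite 32 (Const 0) (Add (V 32) (V 5)))) (LWrite 5 (Const 0) (V 32)))))"

lemma run_pow_prog: "run pow_prog s 5 0 = s 4 0 ^ s 3 0"
proof -
  let ?A = "LFor 19 4 (LWrite 32 (Const 0) (Add (V 32) (V 5)))"
  let ?P = "LSeq (LWrite 32 (Const 0) (Const 0)) (LSeq ?A (LWrite 5 (Const 0) (V 32)))"
  have A: "run ?A s' 32 0 = s' 32 0 + s' 4 0 * s' 5 0" for s'
    by (rule run_LFor_rule[where N = "s' 4 0" and I = "\<lambda>i t. t 32 0 = s' 32 0 + i * s' 5 0"]) auto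
  define s1 where "s1 = run (LWrite 5 (Const 0) (Const 1)) s"
  have s1: "s1 3 = s 3" "s1 4 = s 4" "s1 5 0 = 1" by (auto simp: s1_def)
  have "run (LFor 18 3 ?P) s1 5 0 = s1 4 0 ^ s1 3 0"
  proof (rule run_LFor_rule[where N = "s1 3 0" and I = "\<lambda>i t. t 5 0 = s1 4 0 ^ i"])
    fix i s' assume a: "\<And>x. x \<notin> writes ?P \<Longrightarrow> x \<noteq> 18 \<Longrightarrow> s' x = s1 x" "s' 5 0 = s1 4 0 ^ i"
    have "s' 4 = s1 4" using a(1) by simp
    then show "put 18 (Suc i) (run ?P s') 5 0 = s1 4 0 ^ Suc i"
      using a(2) A by (simp del: run.simps(5))
  qed (auto simp: s1)
  then show ?thesis unfolding pow_prog_def run.simps(3) s1_def[symmetric] s1 by simp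
qed

text \<open>Division by counting: array 13 runs through all \<open>m = i * b + j\<close>, while the
  two loop counters are the quotient and the remainder.\<close>

definition digit_prog :: loop where
  "digit_prog = LSeq (LWrite 13 (Const 0) (Const 0))
     (LFor 18 5 (LFor 19 4 (LSeq (LWrite 11 (V 13) (V 18)) (LSeq (LWrite 12 (V 13) (V 19))
       (LWrite 13 (Const 0) (Add (V 13) (Const 1)))))))"

lemma run_digit_prog:
  assumes "s 5 0 = Q" "s 4 0 = b" "m < Q * b"
  shows "run digit_prog s 11 m = m div b" "run digit_prog s 12 m = m mod b"
proof -
  let ?B = "LSeq (LWrite 11 (V 13) (V 18)) (LSeq (LWrite 12 (V 13) (V 19))
       (LWrite 13 (Const 0) (Add (V 13) (Const 1))))"
  define s1 where "s1 = run (LWrite 13 (Const 0) (Const 0)) s"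
  let ?I = "\<lambda>M t. t 13 0 = M \<and> (\<forall>m<M. t 11 m = m div b \<and> t 12 m = m mod b)"
  have s1: "s1 5 0 = Q" "s1 4 0 = b" "s1 13 0 = 0" using assms by (auto simp: s1_def)
  have "?I (Q * b) (run (LFor 18 5 (LFor 19 4 ?B)) s1)"
  proof (rule run_LFor_rule[where N = Q and I = "\<lambda>i t. ?I (i * b) t"])
    fix i s2 assume a: "s2 18 0 = i" "\<And>x. x \<notin> writes (LFor 19 4 ?B) \<Longrightarrow> x \<noteq> 18 \<Longrightarrow> s2 x = s1 x" "?I (i * b) s2"
    have "?I (i * b + b) (run (LFor 19 4 ?B) s2)"
    proof (rule run_LFor_rule[where N = b and I = "\<lambda>j t. ?I (i * b + j) t"])
      fix j s3 assume b: "j < b" "s3 19 0 = j" "\<And>x. x \<notin> writes ?B \<Longrightarrow> x \<noteq> 19 \<Longrightarrow> s3 x = s2 x" "?I (i * b + j) s3"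
      have "s3 18 0 = i" using b(3)[of 18] a(1) by simp
      then show "?I (i * b + Suc j) (put 19 (Suc j) (run ?B s3))"
        using b by (auto simp: less_Suc_eq)
    next
      show "s2 4 0 = b" using a(2)[of 4] s1 by simp
    qed (use a in auto)
    then show "?I (Suc i * b) (put 18 (Suc i) (run (LFor 19 4 ?B) s2))" by (simp add: add.commute del: run.simps(5))
  qed (use s1 in auto)
  then have "?I (Q * b) (run digit_prog s)"
    unfolding digit_prog_def run.simps(3) s1_def[symmetric] by simp
  then show "run digit_prog s 11 m = m div b" "run digit_prog s 12 m = m mod b" using assms(3) by auto
qed

section \<open>The machine program for the search\<close>

section \<open>The search as a program\<close>

text \<open>The robber layer is read from the input itself, where its matrix follows the three
  header cells.\<close>

definition tables :: "nat mlgraph \<Rightarrow> nat \<Rightarrow> state \<Rightarrow> bool" where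
  "tables G n s \<longleftrightarrow> offsets n (length (cop_layers G)) s \<and>
     (\<forall>l<length (cop_layers G). \<forall>u<n. \<forall>v<n.
        (s 9 (ix n l u v) \<noteq> 0 \<longleftrightarrow> (u, v) \<in> (edge_rel (cop_layers G ! l))\<^sup>*) \<and>
        (s 10 (ix n l u v) \<noteq> 0 \<longleftrightarrow> near (cop_layers G ! l) u v)) \<and>
     (\<forall>u<n. \<forall>v<n. s 0 (3 + (u * n + v)) \<noteq> 0 \<longleftrightarrow> {u, v} \<in> robber_layer G)"

lemma tables_cong:
  assumes "s' 0 = s 0" "s' 1 = s 1" "s' 2 = s 2" "s' 6 = s 6" "s' 7 = s 7" "s' 9 = s 9" "s' 10 = s 10"
  shows "tables G n s' = tables G n s"
  using assms offsets_cong[of s' s] by (simp add: tables_def)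

text \<open>Array 25 cuts off a prefix of arrays 28 and 29, so cops left there by an earlier branch
  of the search are ignored.\<close>

definition board :: "(nat \<times> nat) list \<Rightarrow> state \<Rightarrow> bool" where
  "board cs s \<longleftrightarrow> s 25 0 = length cs \<and> (\<forall>j<length cs. s 28 j = fst (cs ! j) \<and> s 29 j = snd (cs ! j))"

lemma board_cong:
  assumes "s' 25 = s 25" "s' 28 = s 28" "s' 29 = s 29"
  shows "board cs s' = board cs s"
  using assms by (simp add: board_def)

definition weightE :: expr where
  "weightE =
     (let c = (\<lambda>e. Read 9 (ixE (Read 28 (V 19)) (Read 29 (V 19)) e)) in
      Add (orE (c (V 16)) (c (V 17)))
        (andE (andE (c (V 16)) (c (V 17))) (Read 10 (ixE (Read 28 (V 19)) (V 16) (V 17)))))"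

lemma val_weightE:
  assumes "tables G n s" "s 28 (s 19 0) < length (cop_layers G)" "s 29 (s 19 0) < n" "s 16 0 < n" "s 17 0 < n"
  shows "val weightE s = weight (cop_layers G ! s 28 (s 19 0)) (s 29 (s 19 0)) (s 16 0) (s 17 0)"
proof -
  have "offsets n (length (cop_layers G)) s" using assms(1) by (simp add: tables_def)
  then show ?thesis using assms by (simp add: weightE_def Let_def tables_def weight_def)
qed

text \<open>The loop runs to \<open>k\<close>, not to the current number of cops: array 25 is
  written during the search and may not bound a loop. The test skips the cells beyond the
  list.\<close>

definition score_prog :: loop where
  "score_prog = LSeq (LWrite 21 (Const 0) (Const 0))
     (LFor 19 3 (LIf (Sub (V 25) (V 19)) (LWrite 21 (Const 0) (Add (V 21) weightE)) LSkip))"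

lemma run_score_prog:
  assumes G: "verts G = {..<n}" and s: "tables G n s" "board cs s" "length cs \<le> s 3 0" "placement G cs"
    and uv: "s 16 0 < n" "s 17 0 < n"
  shows "run score_prog s 21 0 = score G cs (s 16 0) (s 17 0)"
proof -
  let ?A = "LWrite 21 (Const 0) (Const 0)"
  let ?P = "LIf (Sub (V 25) (V 19)) (LWrite 21 (Const 0) (Add (V 21) weightE)) LSkip"
  define s1 where "s1 = run ?A s"
  have s1: "s1 x = s x" if "x \<noteq> 21" for x using that by (simp add: s1_def)
  have s1_0: "s1 21 0 = 0" by (simp add: s1_def)
  have "run (LFor 19 3 ?P) s1 21 0 = score G (take (s 3 0) cs) (s 16 0) (s 17 0)"
  proof (rule run_LFor_rule[where N = "s 3 0" and I = "\<lambda>i t. t 21 0 = score G (take i cs) (s 16 0) (s 17 0)"])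
    fix i t assume a: "i < s 3 0" "t 19 0 = i" "\<And>x. x \<notin> writes ?P \<Longrightarrow> x \<noteq> 19 \<Longrightarrow> t x = s1 x"
      "t 21 0 = score G (take i cs) (s 16 0) (s 17 0)"
    have t: "t x = s x" if "x \<noteq> 21" "x \<noteq> 19" for x using a(3)[of x] s1 that by simp
    have tb: "tables G n t" "board cs t" using s t tables_cong[of t s] board_cong[of t s] by simp_all
    show "put 19 (Suc i) (run ?P t) 21 0 = score G (take (Suc i) cs) (s 16 0) (s 17 0)"
    proof (cases "i < length cs")
      case True
      have "cs ! i \<in> {..<length (cop_layers G)} \<times> {..<n}"
        using s(4) True nth_mem unfolding placement_def G by blast
      then have "val weightE t = weight (cop_layers G ! fst (cs ! i)) (snd (cs ! i)) (s 16 0) (s 17 0)"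
        using val_weightE[OF tb(1)] tb(2) True a(2) uv t by (auto simp: board_def)
      then show ?thesis using a(2,4) tb(2) True by (simp add: board_def take_Suc_conv_app_nth)
    next
      case False
      then show ?thesis using a(2,4) tb(2) by (simp add: board_def)
    qed
  qed (use s1 s1_0 in auto)
  then show ?thesis using s(3) unfolding score_prog_def run.simps(3) s1_def[symmetric] by simp
qed

definition pairE :: expr where
  "pairE = orE (eqE (V 16) (V 17)) (Read 0 (Add (Const 3) (Add (Read 6 (V 16)) (V 17))))"

definition scan_prog :: loop where
  "scan_prog =
     LSeq (LSeq (LWrite 22 (Const 0) (Const 0)) (LSeq (LWrite 23 (Const 0) (Const 0)) (LWrite 24 (Const 0) (Const 0))))
       (LFor 16 1 (LFor 17 1
         (LIf pairE
           (LSeq score_prog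
             (LIf (Sub (Const 2) (V 21))
               (LSeq (LWrite 22 (Const 0) (Const 1)) (LSeq (LWrite 23 (Const 0) (V 16)) (LWrite 24 (Const 0) (V 17))))
               LSkip))
           LSkip)))"

lemma writes_score_prog [simp]: "writes score_prog = {19, 21}"
  by (auto simp: score_prog_def)

lemma writes_scan_prog [simp]: "writes scan_prog = {16, 17, 19, 21, 22, 23, 24}"
  by (auto simp: scan_prog_def)

lemma run_scan_prog:
  assumes G: "verts G = {..<n}" and s: "tables G n s" "board cs s" "length cs \<le> s 3 0" "placement G cs"
  shows "(run scan_prog s 22 0, run scan_prog s 23 0, run scan_prog s 24 0) = scan G n cs"
proof -
  let ?A = "LSeq (LWrite 22 (Const 0) (Const 0)) (LSeq (LWrite 23 (Const 0) (Const 0)) (LWrite 24 (Const 0) (Const 0)))"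
  let ?B = "LIf (Sub (Const 2) (V 21))
      (LSeq (LWrite 22 (Const 0) (Const 1)) (LSeq (LWrite 23 (Const 0) (V 16)) (LWrite 24 (Const 0) (V 17)))) LSkip"
  let ?P = "LIf pairE (LSeq score_prog ?B) LSkip"
  let ?r = "\<lambda>t. (t 22 0, t 23 0, t 24 0)"
  let ?f = "\<lambda>u v r. if exposed G cs u v then (1, u, v) else r"
  define s1 where "s1 = run ?A s"
  have s1: "s1 x = s x" if "x \<notin> {22, 23, 24}" for x using that by (simp add: s1_def)
  have s1_0: "?r s1 = (0, 0, 0)" by (simp add: s1_def)
  have s1_n: "s1 1 0 = n" using s1[of 1] s(1) by (simp add: tables_def offsets_def)
  have "?r (run (LFor 16 1 (LFor 17 1 ?P)) s1) = fold (\<lambda>u. fold (?f u) [0..<n]) [0..<n] (0, 0, 0)"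
  proof (rule run_LFor_rule[where N = n and I = "\<lambda>i t. ?r t = fold (\<lambda>u. fold (?f u) [0..<n]) [0..<i] (0, 0, 0)"])
    fix u s2
    let ?o = "fold (\<lambda>u. fold (?f u) [0..<n]) [0..<u] (0, 0, 0)"
    assume a: "u < n" "s2 16 0 = u" "\<And>x. x \<notin> writes (LFor 17 1 ?P) \<Longrightarrow> x \<noteq> 16 \<Longrightarrow> s2 x = s1 x" "?r s2 = ?o"
    have "?r (run (LFor 17 1 ?P) s2) = fold (?f u) [0..<n] ?o"
    proof (rule run_LFor_rule[where N = n and I = "\<lambda>i t. ?r t = fold (?f u) [0..<i] ?o"])
      fix v t
      assume b: "v < n" "t 17 0 = v" "\<And>x. x \<notin> writes ?P \<Longrightarrow> x \<noteq> 17 \<Longrightarrow> t x = s2 x"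
        "?r t = fold (?f u) [0..<v] ?o"
      have t: "t x = s x" if "x \<notin> {16, 17, 19, 21, 22, 23, 24}" for x
        using a(3)[of x] b(3)[of x] s1 that by simp
      have tb: "tables G n t" "board cs t" "length cs \<le> t 3 0"
        using s t tables_cong[of t s] board_cong[of t s] by simp_all
      have t16: "t 16 0 = u" using b(3)[of 16] a(2) by simp
      have off: "offsets n (length (cop_layers G)) t" using tb(1) by (simp add: tables_def)
      define t' where "t' = run score_prog t"
      have t': "t' x = t x" if "x \<notin> {19, 21}" for x using that by (simp add: t'_def run_frame)
      have sc: "t' 21 0 = score G cs u v"
        using run_score_prog[OF G tb s(4)] t16 b(1,2) a(1) by (simp add: t'_def)
      have "val pairE t = of_bool (u = v \<or> {u, v} \<in> robber_layer G)"
        using tb(1) off t16 b(1,2) a(1) by (simp add: pairE_def tables_def offsets_def)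
      then have "?r (run ?P t) = ?f u v (?r t)"
        using sc t'[of 16] t'[of 17] t'[of 22] t'[of 23] t'[of 24] t16 b(2)
        by (auto simp: t'_def[symmetric] exposed_def)
      then have "?r (run ?P t) = fold (?f u) [0..<Suc v] ?o" unfolding b(4) by simp
      then show "?r (put 17 (Suc v) (run ?P t)) = fold (?f u) [0..<Suc v] ?o"
        by (simp del: run.simps)
    next
      show "s2 1 0 = n" using a(3)[of 1] s1_n by simp
    qed (use a in auto)
    then show "?r (put 16 (Suc u) (run (LFor 17 1 ?P) s2)) = fold (\<lambda>u. fold (?f u) [0..<n]) [0..<Suc u] (0, 0, 0)"
      by (simp del: run.simps One_nat_def)
  qed (use s1_n s1_0 in auto)
  then show ?thesis unfolding scan_prog_def run.simps(3)[of ?A] s1_def[symmetric] scan_def .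
qed

definition place_prog :: loop where
  "place_prog =
     LIf (Sub (V 2) (V 26))
       (LSeq (LWrite 28 (V 18) (V 26)) (LWrite 29 (V 18) (V 23)))
       (LSeq (LWrite 28 (V 18) (Sub (V 26) (V 2))) (LWrite 29 (V 18) (V 24)))"

text \<open>The digits are consumed in array 27, since array 20 with \<open>q\<close> is the counter
  of the search loop and must keep its value.\<close>

definition grow_prog :: loop where
  "grow_prog = LSeq (LWrite 27 (Const 0) (V 20))
     (LFor 18 3
       (LSeq (LWrite 25 (Const 0) (V 18))
         (LSeq scan_prog
           (LSeq (LSeq (LWrite 26 (Const 0) (Read 12 (V 27))) (LWrite 27 (Const 0) (Read 11 (V 27))))
             place_prog))))"

lemma writes_place_prog [simp]: "writes place_prog = {28, 29}"
  by (auto simp: place_prog_def)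

lemma writes_grow_prog [simp]: "writes grow_prog = {16, 17, 18, 19, 21, 22, 23, 24, 25, 26, 27, 28, 29}"
  by (auto simp: grow_prog_def)

definition digits :: "nat \<Rightarrow> nat \<Rightarrow> state \<Rightarrow> bool" where
  "digits b Q s \<longleftrightarrow> (\<forall>m<Q * b. s 11 m = m div b \<and> s 12 m = m mod b)"

lemma digits_cong: "s' 11 = s 11 \<Longrightarrow> s' 12 = s 12 \<Longrightarrow> digits b Q s' = digits b Q s"
  by (simp add: digits_def)

lemma run_grow_prog:
  assumes G: "verts G = {..<n}" "0 < n" and s: "tables G n s" "s 3 0 = k" "s 20 0 = q"
    and b: "b = 2 * length (cop_layers G)" "digits b (b ^ k) s" "q < b ^ k"
  shows "\<forall>j<k. (run grow_prog s 28 j, run grow_prog s 29 j) = grow G n q k ! j"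
proof -
  let ?A = "LWrite 27 (Const 0) (V 20)"
  let ?D = "LSeq (LWrite 26 (Const 0) (Read 12 (V 27))) (LWrite 27 (Const 0) (Read 11 (V 27)))"
  let ?P = "LSeq (LWrite 25 (Const 0) (V 18)) (LSeq scan_prog (LSeq ?D place_prog))"
  let ?I = "\<lambda>i t. t 27 0 = q div b ^ i \<and> (\<forall>j<i. (t 28 j, t 29 j) = grow G n q i ! j)"
  define s1 where "s1 = run ?A s"
  have s1: "s1 x = s x" if "x \<noteq> 27" for x using that by (simp add: s1_def)
  have s1_0: "s1 27 0 = q" using s by (simp add: s1_def)
  have "?I k (run (LFor 18 3 ?P) s1)"
  proof (rule run_LFor_rule[where N = k and I = ?I])
    fix i t
    assume a: "i < k" "t 18 0 = i" "\<And>x. x \<notin> writes ?P \<Longrightarrow> x \<noteq> 18 \<Longrightarrow> t x = s1 x" and I: "?I i t"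
    have t: "t x = s x" if "x \<notin> {16, 17, 18, 19, 21, 22, 23, 24, 25, 26, 27, 28, 29}" for x
      using a(3)[of x] s1 that by simp
    have b0: "0 < b" using a(1) b(3) by (cases b; cases k) auto
    then have "placement G (grow G n q i)" using placement_grow[OF G] b(1) by simp
    define t1 where "t1 = run (LWrite 25 (Const 0) (V 18)) t"
    have t1: "t1 x = t x" if "x \<noteq> 25" for x using that by (simp add: t1_def)
    have "tables G n t1" "t1 3 0 = k" using s t t1 tables_cong[of t1 s] by simp_all
    moreover have "board (grow G n q i) t1"
      using I a(2) t1[of 28] t1[of 29] by (auto simp: board_def t1_def prod_eq_iff)
    moreover define t2 where "t2 = run scan_prog t1"
    ultimately have sc: "(t2 22 0, t2 23 0, t2 24 0) = scan G n (grow G n q i)"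
      using run_scan_prog[OF G(1), of t1 "grow G n q i"] a(1) \<open>placement G _\<close> by simp
    have t2: "t2 x = t x" if "x \<notin> {16, 17, 19, 21, 22, 23, 24, 25}" for x
      using that t1 by (simp add: t2_def run_frame)
    define t3 where "t3 = run ?D t2"
    \<comment> \<open>The quotient and remainder tables extend far enough, as the successive
      quotients never exceed \<open>q\<close>.\<close>
    have "q div b ^ i < b ^ k * b"
    proof -
      have "q div b ^ i \<le> q" by simp
      also have "q < b ^ k" by (fact b(3))
      also have "b ^ k \<le> b ^ k * b" using b0 by simp
      finally show ?thesis .
    qed
    then have dg: "t2 11 (q div b ^ i) = q div b ^ i div b" "t2 12 (q div b ^ i) = q div b ^ i mod b"
      using b(2) t[of 11] t[of 12] t2[of 11] t2[of 12] by (simp_all add: digits_def)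
    have t3: "t3 x = t2 x" if "x \<notin> {26, 27}" for x using that by (simp add: t3_def)
    have t3_dg: "t3 26 0 = q div b ^ i mod b" "t3 27 0 = q div b ^ Suc i"
      using I t2[of 27] dg by (simp_all add: t3_def div_mult2_eq power_Suc2 del: power_Suc)
    define t4 where "t4 = run place_prog t3"
    have t4: "t4 x = t3 x" if "x \<notin> {28, 29}" for x using that by (simp add: t4_def run_frame)
    have \<tau>: "t3 2 0 = length (cop_layers G)" "t3 18 0 = i"
      using s(1) t[of 2] t2[of 2] t2[of 18] t3[of 2] t3[of 18] a(2) by (simp_all add: tables_def offsets_def)
    have t3b: "t3 28 = t 28" "t3 29 = t 29" "t3 23 = t2 23" "t3 24 = t2 24" using t2 t3 by simp_all
    obtain f u v where fuv: "scan G n (grow G n q i) = (f, u, v)" by (metis prod_cases3)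
    have g: "grow G n q (Suc i) = grow G n q i @ [if q div b ^ i mod b < length (cop_layers G)
        then (q div b ^ i mod b, u) else (q div b ^ i mod b - length (cop_layers G), v)]"
      using fuv by (simp add: Let_def extend_def b(1)[symmetric])
    have "(t4 28 j, t4 29 j) = grow G n q (Suc i) ! j" if "j < Suc i" for j
    proof (cases "j = i")
      case True
      then show ?thesis unfolding g using sc fuv t3_dg \<tau> t3b
        by (auto simp: t4_def place_prog_def nth_append)
    next
      case False
      then have "(t4 28 j, t4 29 j) = (t 28 j, t 29 j)"
        using \<tau> t3b by (simp add: t4_def place_prog_def)
      then show ?thesis unfolding g using I that False by (simp add: nth_append)
    qed
    moreover have "t4 27 0 = q div b ^ Suc i" using t4 t3_dg by simp
    ultimately have "?I (Suc i) t4" by blast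
    moreover have "run ?P t = t4" by (simp only: run.simps(3) t1_def t2_def t3_def t4_def)
    ultimately show "?I (Suc i) (put 18 (Suc i) (run ?P t))" by simp
  qed (use s s1 s1_0 in auto)
  then show ?thesis unfolding grow_prog_def run.simps(3)[of ?A] s1_def[symmetric] by blast
qed

text \<open>When \<open>grow_prog\<close> ends after at least one round, array 25 still excludes the
  last cop; setting it to \<open>k\<close> makes the final scan see the whole list.\<close>

definition search_prog :: loop where
  "search_prog =
     LFor 20 5 (LSeq grow_prog (LSeq (LWrite 25 (Const 0) (V 3))
       (LSeq scan_prog (LIf (V 22) LSkip (LWrite 30 (Const 0) (Const 1))))))"

lemma run_search_prog:
  assumes G: "verts G = {..<n}" "0 < n" and s: "tables G n s" "s 3 0 = k" "s 30 0 = 0"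
    and b: "b = 2 * length (cop_layers G)" "digits b (b ^ k) s" "s 5 0 = b ^ k"
  shows "run search_prog s 30 0 = of_bool (\<exists>q<b ^ k. safe G (grow G n q k))"
  unfolding search_prog_def
proof (rule run_LFor_rule[where N = "b ^ k" and I = "\<lambda>i t. t 30 0 = of_bool (\<exists>q<i. safe G (grow G n q k))"])
  let ?E = "LIf (V 22) LSkip (LWrite 30 (Const 0) (Const 1))"
  let ?P = "LSeq grow_prog (LSeq (LWrite 25 (Const 0) (V 3)) (LSeq scan_prog ?E))"
  fix q t
  assume a: "q < b ^ k" "t 20 0 = q" "\<And>x. x \<notin> writes ?P \<Longrightarrow> x \<noteq> 20 \<Longrightarrow> t x = s x"
    "t 30 0 = of_bool (\<exists>q'<q. safe G (grow G n q' k))"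
  have t: "t x = s x" if "x \<in> {0, 1, 2, 3, 6, 7, 9, 10, 11, 12}" for x
    using a(3)[of x] that by auto
  have tb: "tables G n t" "t 3 0 = k" "digits b (b ^ k) t"
    using s b t tables_cong[of t s] digits_cong[of t s] by simp_all
  define t1 where "t1 = run grow_prog t"
  have t1: "t1 x = t x" if "x \<notin> {16, 17, 18, 19, 21, 22, 23, 24, 25, 26, 27, 28, 29}" for x
    using that by (simp add: t1_def run_frame)
  have gr: "\<forall>j<k. (t1 28 j, t1 29 j) = grow G n q k ! j"
    unfolding t1_def by (rule run_grow_prog) (use G tb a b in auto)
  define t2 where "t2 = run (LWrite 25 (Const 0) (V 3)) t1"
  have t2: "t2 x = t1 x" if "x \<noteq> 25" for x using that by (simp add: t2_def)
  have "tables G n t2" "t2 3 0 = k" using tb t1 t2 tables_cong[of t2 t] by simp_all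
  moreover have "board (grow G n q k) t2"
    using gr tb(2) t1[of 3] t2[of 28] t2[of 29] by (auto simp: board_def t2_def prod_eq_iff)
  moreover have "placement G (grow G n q k)"
  proof (cases k)
    case (Suc k')
    then have "0 < b" using a(1) by (cases b) auto
    then show ?thesis using placement_grow[OF G] b(1) by simp
  qed (simp add: placement_def)
  moreover define t3 where "t3 = run scan_prog t2"
  ultimately have "(t3 22 0, t3 23 0, t3 24 0) = scan G n (grow G n q k)"
    using run_scan_prog[OF G(1), of t2 "grow G n q k"] by simp
  then have "t3 22 0 = 0 \<longleftrightarrow> safe G (grow G n q k)"
    using scan_safe_iff[OF G(1)] by (metis fst_conv)
  moreover have "t3 30 = t 30" using t1 t2 by (simp add: t3_def run_frame)
  moreover have "run ?P t = run ?E t3" by (simp only: run.simps(3) t1_def t2_def t3_def)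
  ultimately show "put 20 (Suc q) (run ?P t) 30 0 = of_bool (\<exists>q'<Suc q. safe G (grow G n q' k))"
    using a(4) by (auto simp: less_Suc_eq simp del: run.simps(3))
qed (use s b in auto)

section \<open>Input layout, the complete program and its time\<close>

section \<open>The running time\<close>

lemma nth_concat_equal_length:
  assumes "\<forall>xs\<in>set xss. length xs = m" "i < length xss" "j < m"
  shows "concat xss ! (i * m + j) = xss ! i ! j"
  using assms
proof (induction xss arbitrary: i)
  case (Cons xs xss)
  then show ?case by (cases i) (auto simp: nth_append)
qed simp

lemma length_adj_matrix [simp]: "length (adj_matrix n E) = n * n"
  by (simp add: adj_matrix_def length_concat comp_def sum_list_triv)

lemma nth_adj_matrix:
  "u < n \<Longrightarrow> v < n \<Longrightarrow> adj_matrix n E ! (u * n + v) = of_bool ({u, v} \<in> E)"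
  by (simp add: adj_matrix_def nth_concat_equal_length)

lemma pair_index_less:
  assumes "u < m" "v < (n :: nat)"
  shows "u * n + v < m * n"
proof -
  have "u * n + v < Suc u * n" using assms by simp
  also have "\<dots> \<le> m * n" using assms by (intro mult_right_mono) auto
  finally show ?thesis .
qed

lemma init_encode:
  fixes G :: "nat mlgraph" and k n :: nat
  assumes "verts G = {..<n}"
  defines "s \<equiv> init_state (encode G k)"
  shows "s 0 0 = n" "s 0 1 = length (cop_layers G)" "s 0 2 = k"
    and "u < n \<Longrightarrow> v < n \<Longrightarrow> s 0 (3 + (u * n + v)) = of_bool ({u, v} \<in> robber_layer G)"
    and "l < length (cop_layers G) \<Longrightarrow> u < n \<Longrightarrow> v < n \<Longrightarrow>
           s 0 (3 + n * n + ix n l u v) = of_bool ({u, v} \<in> cop_layers G ! l)"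
proof -
  let ?c = "concat (map (adj_matrix n) (cop_layers G))"
  have enc: "encode G k = [n, length (cop_layers G), k] @ adj_matrix n (robber_layer G) @ ?c"
    using assms by (simp add: encode_def)
  show "s 0 0 = n" "s 0 1 = length (cop_layers G)" "s 0 2 = k"
    by (simp_all add: s_def init_state_def enc)
  have add3: "3 + i = Suc (Suc (Suc i))" for i by simp
  { assume uv: "u < n" "v < n"
    show "s 0 (3 + (u * n + v)) = of_bool ({u, v} \<in> robber_layer G)"
      using nth_adj_matrix[OF uv] pair_index_less[OF uv]
      by (simp add: s_def init_state_def enc add3 nth_append)
    assume l: "l < length (cop_layers G)"
    have uv': "u * n + v < n * n" by (rule pair_index_less[OF uv])
    then have "ix n l u v < length (cop_layers G) * (n * n)"
      using pair_index_less[OF l] by (simp add: ix_def)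
    moreover have "length ?c = length (cop_layers G) * (n * n)"
      by (simp add: length_concat comp_def sum_list_triv)
    moreover have "?c ! ix n l u v = of_bool ({u, v} \<in> cop_layers G ! l)"
      using nth_concat_equal_length[of "map (adj_matrix n) (cop_layers G)" "n * n" l "u * n + v"]
        l uv' nth_adj_matrix[OF uv] by (simp add: ix_def)
    ultimately show "s 0 (3 + n * n + ix n l u v) = of_bool ({u, v} \<in> cop_layers G ! l)"
      by (simp add: s_def init_state_def enc add3 nth_append) }
qed

definition copy_prog :: loop where
  "copy_prog = LSeq (LWrite 1 (Const 0) (Read 0 (Const 0))) (LSeq (LWrite 2 (Const 0) (Read 0 (Const 1)))
     (LSeq (LWrite 3 (Const 0) (Read 0 (Const 2))) (LWrite 4 (Const 0) (Add (V 2) (V 2)))))"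

text \<open>The cop matrices start behind the header and the \<open>n * n\<close> cells of the
  robber matrix, and their concatenation is laid out exactly as by \<open>ix\<close>. Adding the
  diagonal turns adjacency into \<open>step_along\<close>.\<close>

definition adjacencyE :: expr where
  "adjacencyE = orE (eqE (V 16) (V 17)) (Read 0 (Add (Add (Const 3) (Read 6 (V 1))) (ixE (V 15) (V 16) (V 17))))"

definition fill_prog :: "nat \<Rightarrow> loop" where
  "fill_prog T = LFor3 (LWrite T (ixE (V 15) (V 16) (V 17)) adjacencyE)"

lemma writes_progs [simp]:
  "writes copy_prog = {1, 2, 3, 4}"
  "writes offset_prog = {6, 7, 15, 16}"
  "writes (fill_prog T) = {T, 15, 16, 17}"
  "writes closure_prog = {9, 14, 15, 16, 17}"
  "writes near_prog = {10, 14, 15, 16, 17}"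
  "writes pow_prog = {5, 18, 19, 32}"
  "writes digit_prog = {11, 12, 13, 18, 19}"
  by (auto simp: copy_prog_def offset_prog_def fill_prog_def closure_prog_def near_prog_def
      pow_prog_def digit_prog_def)

lemma run_fill_prog:
  assumes G: "multilayer_graph G" "verts G = {..<n}" and s: "offsets n (length (cop_layers G)) s"
    and inp: "s 0 = init_state (encode G k) 0" and T: "T \<notin> {0, 1, 2, 6, 7, 15, 16, 17}"
    and b: "l < length (cop_layers G)" "u < n" "v < n"
  shows "run (fill_prog T) s T (ix n l u v) = of_bool (step_along (cop_layers G ! l) u v)"
  unfolding fill_prog_def
proof (rule run_fill[OF s _ _ b])
  fix l u v s'
  assume a: "l < length (cop_layers G)" "u < n" "v < n" "s' 15 0 = l" "s' 16 0 = u" "s' 17 0 = v"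
    "\<And>x. x \<notin> {T, 15, 16, 17} \<Longrightarrow> s' x = s x"
  have "offsets n (length (cop_layers G)) s'"
    using offsets_cong[of s' s] s a(7)[of 1] a(7)[of 2] a(7)[of 6] a(7)[of 7] T by auto
  then have "val (ixE (V 15) (V 16) (V 17)) s' = ix n l u v" "s' 1 0 = n" "s' 6 n = n * n"
    using a(1-6) by (simp, simp_all add: offsets_def)
  moreover have "s' 0 = s 0" using a(7)[of 0] T by auto
  ultimately show "val adjacencyE s' = of_bool (step_along (cop_layers G ! l) u v)"
    using a(1-6) init_encode(5)[OF G(2) a(1-3), where k = k] inp
    by (simp add: adjacencyE_def step_along_def)
qed (use T in auto)

lemma rtrancl_step_along:
  assumes "is_layer {..<n} E"
  shows "{(a, b). a < n \<and> b < n \<and> step_along E a b}\<^sup>* = (edge_rel E)\<^sup>*"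
proof (rule antisym)
  have "{(a, b). a < n \<and> b < n \<and> step_along E a b} \<subseteq> (edge_rel E)\<^sup>*"
    by (auto intro: step_along_rtrancl)
  then show "{(a, b). a < n \<and> b < n \<and> step_along E a b}\<^sup>* \<subseteq> (edge_rel E)\<^sup>*"
    by (rule rtrancl_subset_rtrancl)
  have "edge_rel E \<subseteq> {(a, b). a < n \<and> b < n \<and> step_along E a b}"
    using assms by (auto simp: edge_rel_def is_layer_def step_along_def)
  then show "(edge_rel E)\<^sup>* \<subseteq> {(a, b). a < n \<and> b < n \<and> step_along E a b}\<^sup>*"
    by (rule rtrancl_mono)
qed

definition table_prog :: loop where
  "table_prog = LSeq offset_prog (LSeq (fill_prog 8) (LSeq (fill_prog 9)
     (LSeq closure_prog (LSeq near_prog pow_prog))))"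

lemma run_table_prog:
  assumes G: "multilayer_graph G" "verts G = {..<n}"
    and s: "s = run copy_prog (init_state (encode G k))"
  defines "t \<equiv> run table_prog s"
  shows "tables G n t" "t 5 0 = (2 * length (cop_layers G)) ^ k"
proof -
  let ?\<tau> = "length (cop_layers G)"
  note init = init_encode[OF G(2), where k = k]
  have s0: "s 1 0 = n" "s 2 0 = ?\<tau>" "s 3 0 = k" "s 4 0 = 2 * ?\<tau>" "s 0 = init_state (encode G k) 0"
    using init(1-3) by (simp_all add: s copy_prog_def)
  have sz: "s 6 0 = 0" "s 7 0 = 0" "s 10 i = 0" for i
    by (simp_all add: s copy_prog_def init_state_def)
  define s1 where "s1 = run offset_prog s"
  define s2 where "s2 = run (fill_prog 8) s1"
  define s3 where "s3 = run (fill_prog 9) s2"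
  define s4 where "s4 = run closure_prog s3"
  define s5 where "s5 = run near_prog s4"
  have t: "t = run pow_prog s5"
    by (simp only: t_def table_prog_def run.simps(3) s1_def s2_def s3_def s4_def s5_def)
  have f1: "s1 x = s x" if "x \<notin> {6, 7, 15, 16}" for x
    using that by (simp add: s1_def run_frame)
  have f2: "s2 x = s1 x" if "x \<notin> {8, 15, 16, 17}" for x
    using that by (simp add: s2_def run_frame)
  have f3: "s3 x = s2 x" if "x \<notin> {9, 15, 16, 17}" for x
    using that by (simp add: s3_def run_frame)
  have f4: "s4 x = s3 x" if "x \<notin> {9, 14, 15, 16, 17}" for x
    using that by (simp add: s4_def run_frame)
  have f5: "s5 x = s4 x" if "x \<notin> {10, 14, 15, 16, 17}" for x
    using that by (simp add: s5_def run_frame)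
  have f6: "t x = s5 x" if "x \<notin> {5, 18, 19, 32}" for x
    using that by (simp add: t run_frame)
  have o1: "offsets n ?\<tau> s1" unfolding s1_def by (rule run_offset_prog) (use s0 sz in auto)
  have o2: "offsets n ?\<tau> s2" using o1 f2 offsets_cong[of s2 s1] by simp
  have o3: "offsets n ?\<tau> s3" using o2 f3 offsets_cong[of s3 s2] by simp
  have o4: "offsets n ?\<tau> s4" using o3 f4 offsets_cong[of s4 s3] by simp
  have ot: "offsets n ?\<tau> t" using o4 f5 f6 offsets_cong[of t s4] by simp
  have inp: "s1 0 = init_state (encode G k) 0" "s2 0 = init_state (encode G k) 0"
    "t 0 = init_state (encode G k) 0"
    using s0(5) f1 f2 f3 f4 f5 f6 by simp_all
  have 8: "s2 8 (ix n l u v) = of_bool (step_along (cop_layers G ! l) u v)"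
    if "l < ?\<tau>" "u < n" "v < n" for l u v
    unfolding s2_def by (rule run_fill_prog[OF G o1 inp(1) _ that]) simp
  have 9: "s3 9 (ix n l u v) = of_bool (step_along (cop_layers G ! l) u v)"
    if "l < ?\<tau>" "u < n" "v < n" for l u v
    unfolding s3_def by (rule run_fill_prog[OF G o2 inp(2) _ that]) simp
  have layer: "is_layer {..<n} (cop_layers G ! l)" if "l < ?\<tau>" for l
    using G that by (auto simp: multilayer_graph_def)
  have "t 9 (ix n l u v) \<noteq> 0 \<longleftrightarrow> (u, v) \<in> (edge_rel (cop_layers G ! l))\<^sup>*"
    if b: "l < ?\<tau>" "u < n" "v < n" for l u v
  proof -
    have "{(x, y). x < n \<and> y < n \<and> s3 9 (ix n l x y) \<noteq> 0} =
        {(x, y). x < n \<and> y < n \<and> step_along (cop_layers G ! l) x y}"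
      using 9[OF b(1)] by auto
    moreover have "s4 9 (ix n l u v) \<noteq> 0 \<longleftrightarrow> (u, v) \<in> {(x, y). x < n \<and> y < n \<and> s3 9 (ix n l x y) \<noteq> 0}\<^sup>*"
      unfolding s4_def by (rule run_closure_prog[OF o3 _ b]) (simp add: 9 step_along_def)
    ultimately show ?thesis using rtrancl_step_along[OF layer[OF b(1)]] f5 f6 by simp
  qed
  moreover have "t 10 (ix n l u v) \<noteq> 0 \<longleftrightarrow> near (cop_layers G ! l) u v"
    if b: "l < ?\<tau>" "u < n" "v < n" for l u v
  proof -
    have "s4 10 i = 0" for i using sz f1 f2 f3 f4 by simp
    then have "s5 10 (ix n l u v) \<noteq> 0 \<longleftrightarrow>
        (\<exists>z<n. s4 8 (ix n l u z) \<noteq> 0 \<and> s4 8 (ix n l z v) \<noteq> 0)"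
      unfolding s5_def by (rule run_near_prog[OF o4 _ b])
    also have "\<dots> \<longleftrightarrow> (\<exists>z<n. step_along (cop_layers G ! l) u z \<and> step_along (cop_layers G ! l) z v)"
      using 8 b f3 f4 by auto
    also have "\<dots> \<longleftrightarrow> near (cop_layers G ! l) u v"
    proof -
      have "z < n" if "step_along (cop_layers G ! l) u z" for z
        using that layer[OF b(1)] b(2) by (auto simp: step_along_def is_layer_def)
      then show ?thesis unfolding near_def by (metis step_along_sym)
    qed
    finally show ?thesis using f6 by simp
  qed
  ultimately show "tables G n t"
    using ot init(4) inp(3) by (simp add: tables_def)
  have "s5 4 0 = 2 * ?\<tau>" "s5 3 0 = k" using s0 f1 f2 f3 f4 f5 by simp_all
  then show "t 5 0 = (2 * ?\<tau>) ^ k" unfolding t run_pow_prog by simp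
qed

definition decide_prog :: loop where
  "decide_prog = LSeq digit_prog (LSeq search_prog (LWrite 0 (Const 0) (V 30)))"

lemma writes_table_prog: "writes table_prog \<subseteq> {5, 6, 7, 8, 9, 10, 14, 15, 16, 17, 18, 19, 32}"
  by (auto simp: table_prog_def)

lemma run_decide_prog:
  assumes G: "multilayer_graph G" "verts G = {..<n}" "is_tree (verts G) (robber_layer G)"
  shows "run decide_prog (run table_prog (run copy_prog (init_state (encode G k)))) 0 0 =
    of_bool (multilayer_cops_and_robber G k)"
proof -
  let ?\<tau> = "length (cop_layers G)"
  define s where "s = run copy_prog (init_state (encode G k))"
  define t where "t = run table_prog s"
  define t1 where "t1 = run digit_prog t"
  have n: "0 < n" using G(2,3) by (cases n) (auto simp: is_tree_def connected_graph_def)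
  have t: "tables G n t" "t 5 0 = (2 * ?\<tau>) ^ k"
    using run_table_prog[OF G(1,2) s_def] by (simp_all add: t_def)
  have s: "s 3 0 = k" "s 4 0 = 2 * ?\<tau>" "s 30 0 = 0"
    using init_encode(2,3)[OF G(2), where k = k] by (simp_all add: s_def copy_prog_def init_state_def)
  have fr: "t x = s x" if "x \<in> {3, 4, 30}" for x
    unfolding t_def by (rule run_frame) (use that writes_table_prog in auto)
  have f1: "t1 x = t x" if "x \<notin> {11, 12, 13, 18, 19}" for x
    using that by (simp add: t1_def run_frame)
  have "run search_prog t1 30 0 = of_bool (\<exists>q<(2 * ?\<tau>) ^ k. safe G (grow G n q k))"
  proof (rule run_search_prog[OF G(2) n])
    show "tables G n t1" using t(1) f1 tables_cong[of t1 t] by simp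
    show "t1 3 0 = k" "t1 30 0 = 0" "t1 5 0 = (2 * ?\<tau>) ^ k" using f1 fr s t(2) by simp_all
    show "digits (2 * ?\<tau>) ((2 * ?\<tau>) ^ k) t1"
      using run_digit_prog[of t "(2 * ?\<tau>) ^ k" "2 * ?\<tau>"] t(2) fr s(2) by (simp add: digits_def t1_def)
  qed simp
  then show ?thesis
    unfolding decide_prog_def run.simps(3) s_def[symmetric] t_def[symmetric] t1_def[symmetric]
    by (simp add: multilayer_iff_grow[OF G(1,3,2)])
qed

text \<open>Three parts, because a loop bound may not be written by the part containing the loop:
  the first sets arrays 1 to 4, which bound loops of the second, and the second sets array 5, which
  bounds loops of the third.\<close>

definition solver :: prog where
  "solver = Seq (compile copy_prog) (Seq (compile table_prog) (compile decide_prog))"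

primrec timesE :: "nat \<Rightarrow> expr \<Rightarrow> expr" where
  "timesE 0 e = Const 0"
| "timesE (Suc d) e = Add e (timesE d e)"

lemma val_timesE [simp]: "val (timesE d e) s = d * val e s"
  by (induction d) auto

text \<open>\<open>pow_prog\<close> does the work once base and exponent stand in arrays 4 and 3;
  the fixed factor \<open>d\<close> is a repeated addition inside one expression.\<close>

lemma computable2_power: "computable2 (\<lambda>k \<tau>. (2 * \<tau> + k + 1) ^ ((k + 1) * d))"
proof -
  let ?x = "Read 0 (Const 0)" and ?y = "Read 0 (Const 1)"
  let ?P = "LSeq (LWrite 4 (Const 0) (Add (Add ?y ?y) (Add ?x (Const 1))))
    (LWrite 3 (Const 0) (timesE d (Add ?x (Const 1))))"
  let ?Q = "LSeq pow_prog (LWrite 0 (Const 0) (V 5))"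
  have "\<exists>t. computes_in_time (Seq (compile ?P) (compile ?Q)) [x, y] ((2 * y + x + 1) ^ ((x + 1) * d)) t" for x y
  proof -
    let ?s = "init_state [x, y]"
    obtain t1 where t1: "exec (compile ?P) ?s t1 (run ?P ?s)"
      using exec_compile[of ?P] by auto
    have "wf_loop ?Q" "bounds ?Q \<inter> writes ?Q = {}" by (auto simp: pow_prog_def)
    then obtain t2 where t2: "exec (compile ?Q) (run ?P ?s) t2 (run ?Q (run ?P ?s))"
      using exec_compile by blast
    define s1 where "s1 = run ?P ?s"
    have "s1 4 0 = 2 * y + x + 1" "s1 3 0 = (x + 1) * d"
      by (simp_all add: s1_def init_state_def)
    then have "run ?Q s1 0 0 = (2 * y + x + 1) ^ ((x + 1) * d)"
      using run_pow_prog[of s1] by simp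
    then have "run ?Q (run ?P ?s) 0 0 = (2 * y + x + 1) ^ ((x + 1) * d)" unfolding s1_def .
    then show ?thesis unfolding computes_in_time_def using exec.Seq[OF t1 t2] by blast
  qed
  then show ?thesis unfolding computable2_def by blast
qed

lemma solver_loops:
  "wf_loop copy_prog" "bounds copy_prog \<inter> writes copy_prog = {}"
  "wf_loop table_prog" "bounds table_prog \<inter> writes table_prog = {}"
  "wf_loop decide_prog" "bounds decide_prog \<inter> writes decide_prog = {}"
  "bounds table_prog \<subseteq> {1, 2, 3, 4}" "bounds decide_prog \<subseteq> {1, 3, 4, 5}" "bounds copy_prog = {}"
  by (auto simp: copy_prog_def table_prog_def decide_prog_def offset_prog_def fill_prog_def
      closure_prog_def near_prog_def join_prog_def pow_prog_def LFor3_def digit_prog_def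
      search_prog_def grow_prog_def scan_prog_def score_prog_def place_prog_def)

lemma solver_time:
  obtains c d where "\<And>G k n. multilayer_graph G \<Longrightarrow> verts G = {..<n} \<Longrightarrow>
    is_tree (verts G) (robber_layer G) \<Longrightarrow>
    \<exists>t. computes_in_time solver (encode G k) (of_bool (multilayer_cops_and_robber G k)) t \<and>
      t \<le> c * ((n + 1) * (2 * length (cop_layers G) + k + 1) ^ (k + 1)) ^ d"
proof -
  obtain c0 d0 where b0: "\<And>N Z. \<forall>b\<in>bounds copy_prog. N b \<le> Z \<Longrightarrow> 1 \<le> Z \<Longrightarrow>
      time_bound copy_prog N \<le> c0 * Z ^ d0"
    using time_bound_power by metis
  obtain c1 d1 where b1: "\<And>N Z. \<forall>b\<in>bounds table_prog. N b \<le> Z \<Longrightarrow> 1 \<le> Z \<Longrightarrow>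
      time_bound table_prog N \<le> c1 * Z ^ d1"
    using time_bound_power by metis
  obtain c2 d2 where b2: "\<And>N Z. \<forall>b\<in>bounds decide_prog. N b \<le> Z \<Longrightarrow> 1 \<le> Z \<Longrightarrow>
      time_bound decide_prog N \<le> c2 * Z ^ d2"
    using time_bound_power by metis
  have "\<exists>t. computes_in_time solver (encode G k) (of_bool (multilayer_cops_and_robber G k)) t \<and>
      t \<le> (c0 + c1 + c2) * ((n + 1) * (2 * length (cop_layers G) + k + 1) ^ (k + 1)) ^ (d0 + d1 + d2)"
    if G: "multilayer_graph G" "verts G = {..<n}" "is_tree (verts G) (robber_layer G)" for G k n
  proof -
    define \<tau> where "\<tau> = length (cop_layers G)"
    \<comment> \<open>The exponent \<open>k + 1\<close> makes \<open>M\<close> at least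
      \<open>2 * \<tau> + k + 1\<close> even for \<open>k = 0\<close>. Thus \<open>Z\<close>
      dominates every loop bound, including the number \<open>(2 * \<tau>) ^ k\<close> of
      branches.\<close>
    define M where "M = (2 * \<tau> + k + 1) ^ (k + 1)"
    define Z where "Z = (n + 1) * M"
    define s0 where "s0 = init_state (encode G k)"
    define s1 where "s1 = run copy_prog s0"
    define s2 where "s2 = run table_prog s1"
    obtain t0 where t0: "exec (compile copy_prog) s0 t0 s1" "t0 \<le> time_bound copy_prog (\<lambda>b. s0 b 0)"
      using exec_compile solver_loops unfolding s1_def by blast
    obtain t1 where t1: "exec (compile table_prog) s1 t1 s2" "t1 \<le> time_bound table_prog (\<lambda>b. s1 b 0)"
      using exec_compile solver_loops unfolding s2_def by blast
    obtain t2 where t2: "exec (compile decide_prog) s2 t2 (run decide_prog s2)"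
      "t2 \<le> time_bound decide_prog (\<lambda>b. s2 b 0)"
      using exec_compile solver_loops by blast
    have s1: "s1 1 0 = n" "s1 2 0 = \<tau>" "s1 3 0 = k" "s1 4 0 = 2 * \<tau>"
      using init_encode(1-3)[OF G(2), where k = k] by (simp_all add: s1_def s0_def \<tau>_def copy_prog_def)
    have "s2 5 0 = (2 * \<tau>) ^ k"
      using run_table_prog(2)[OF G(1,2), of s1 k] by (simp add: s2_def s1_def s0_def \<tau>_def)
    moreover have "s2 x = s1 x" if "x \<in> {1, 3, 4}" for x
      unfolding s2_def by (rule run_frame) (use that writes_table_prog in auto)
    ultimately have s2: "s2 1 0 = n" "s2 3 0 = k" "s2 4 0 = 2 * \<tau>" "s2 5 0 = (2 * \<tau>) ^ k"
      using s1 by simp_all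
    have base: "2 * \<tau> + k + 1 \<le> M" unfolding M_def using self_le_power[of "2 * \<tau> + k + 1" "k + 1"] by simp
    have "(2 * \<tau>) ^ k \<le> (2 * \<tau> + k + 1) ^ k" by (intro power_mono) auto
    also have "\<dots> \<le> M" unfolding M_def by (intro power_increasing) auto
    finally have Q: "(2 * \<tau>) ^ k \<le> M" .
    have MZ: "M \<le> Z" by (simp add: Z_def)
    have "1 \<le> M" using base by linarith
    then have "n + 1 \<le> Z" using mult_le_mono2[of 1 M "n + 1"] by (simp only: Z_def mult_1_right)
    then have Z: "n \<le> Z" "\<tau> \<le> Z" "2 * \<tau> \<le> Z" "k \<le> Z" "(2 * \<tau>) ^ k \<le> Z" "1 \<le> Z"
      using base Q MZ by linarith+
    have mono: "c * Z ^ d \<le> c * Z ^ (d0 + d1 + d2)" if "d \<le> d0 + d1 + d2" for c d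
      using that Z(6) by (intro mult_left_mono power_increasing) auto
    have "\<forall>b\<in>{1, 2, 3, 4}. s1 b 0 \<le> Z" "\<forall>b\<in>{1, 3, 4, 5}. s2 b 0 \<le> Z"
      using s1 s2 Z by simp_all
    then have le: "\<forall>b\<in>bounds table_prog. s1 b 0 \<le> Z" "\<forall>b\<in>bounds decide_prog. s2 b 0 \<le> Z"
      "\<forall>b\<in>bounds copy_prog. s0 b 0 \<le> Z"
      using solver_loops(7-9) by auto
    have "t0 \<le> c0 * Z ^ d0" "t1 \<le> c1 * Z ^ d1" "t2 \<le> c2 * Z ^ d2"
      using t0(2) t1(2) t2(2) b0[OF le(3) Z(6)] b1[OF le(1) Z(6)] b2[OF le(2) Z(6)] by linarith+
    then have "t0 + (t1 + t2) \<le> (c0 + c1 + c2) * Z ^ (d0 + d1 + d2)"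
      using mono[of d0 c0] mono[of d1 c1] mono[of d2 c2] unfolding add_mult_distrib by linarith
    moreover have "exec solver s0 (t0 + (t1 + t2)) (run decide_prog s2)"
      unfolding solver_def by (rule exec.Seq[OF t0(1) exec.Seq[OF t1(1) t2(1)]])
    ultimately show ?thesis
      using run_decide_prog[OF G, of k]
      unfolding computes_in_time_def s2_def s1_def s0_def Z_def M_def \<tau>_def by blast
  qed
  then show thesis using that by blast
qed

theorem theorem4p4:
  "\<exists>(P :: prog) (f :: nat \<Rightarrow> nat \<Rightarrow> nat) (p :: nat poly) (c :: nat).
     computable2 f \<and>
     (\<forall>(G :: nat mlgraph) (k :: nat) (n :: nat) (\<tau> :: nat).
        multilayer_graph G \<longrightarrow> verts G = {..<n} \<longrightarrow> length (cop_layers G) = \<tau> \<longrightarrow>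
        is_tree (verts G) (robber_layer G) \<longrightarrow>
        (\<exists>t. computes_in_time P (encode G k) (if multilayer_cops_and_robber G k then 1 else 0) t \<and>
             t \<le> c * (f k \<tau> * poly p n)))"
proof -
  obtain c d where cd: "\<And>G k n. multilayer_graph G \<Longrightarrow> verts G = {..<n} \<Longrightarrow>
    is_tree (verts G) (robber_layer G) \<Longrightarrow>
    \<exists>t. computes_in_time solver (encode G k) (of_bool (multilayer_cops_and_robber G k)) t \<and>
      t \<le> c * ((n + 1) * (2 * length (cop_layers G) + k + 1) ^ (k + 1)) ^ d"
    using solver_time by blast
  \<comment> \<open>The time bound is a power of a product, so it separates into a polynomial in
    \<open>n\<close> and a factor depending only on \<open>k\<close> and
    \<open>\<tau>\<close>.\<close>
  have "poly ([:1, 1:] ^ d) n = (n + 1) ^ d" for n :: nat by (simp add: poly_power)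
  then have "((n + 1) * (2 * \<tau> + k + 1) ^ (k + 1)) ^ d =
      (2 * \<tau> + k + 1) ^ ((k + 1) * d) * poly ([:1, 1:] ^ d) n" for n \<tau> k :: nat
    by (simp only: power_mult_distrib power_mult mult.commute[of "(n + 1) ^ d"])
  then show ?thesis
    using cd computable2_power[of d]
    by (intro exI[of _ solver] exI[of _ "\<lambda>k \<tau>. (2 * \<tau> + k + 1) ^ ((k + 1) * d)"]
        exI[of _ "[:1, 1:] ^ d"] exI[of _ c]) (simp only: of_bool_def, metis)
qed

end
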